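(* Let $\mathcal{C}$ be an isoclinism family (equivalence class under isoclinism) of Lie superalgebras. Then: (1) $\mathcal{C}$ contains a stem Lie superalgebra. (2) A finite dimensional Lie superalgebra $T\in\mathcal{C}$ is stem if and only if $T$ has minimal even and odd dimension in $\mathcal{C}$, i.e. $\dim T_{\bar 0}\le\dim L_{\bar 0}$ and $\dim T_{\bar 1}\le\dim L_{\bar 1}$ for every $L\in\mathcal{C}$.
   Context: All vector superspaces are over a field $\mathbb{F}$ of characteristic different from $2$ and $3$. A Lie superalgebra is a $\mathbb{Z}_2$-graded vector space $L=L_{\bar 0}\oplus L_{\bar 1}$ with a bilinear bracket satisfying, for homogeneous elements, $[L_\alpha,L_\beta]\subseteq L_{\alpha+\beta}$, $[x,y]=-(-1)^{|x||y|}[y,x]$, and $(-1)^{|x||z|}[x,[y,z]]+(-1)^{|y||x|}[y,[z,x]]+(-1)^{|z||y|}[z,[x,y]]=0$. A homomorphism of Lie superalgebras is a bracket-preserving linear map of even degree (preserving the grading). $L^2=[L,L]$ is the span of all $[x,y]$, $x,y\in L$, and $Z(L)=\{z\in L: [z,x]=0 \text{ for all } x\in L\}$. A Lie superalgebra $L$ is called stem if $Z(L)\subseteq L^2$. Two Lie superalgebras $L$ and $K$ are isoclinic if there are Lie superalgebra isomorphisms $\alpha: L/Z(L)\to K/Z(K)$ and $\beta: L^2\to K^2$ that are compatible: $\beta([l,m])=[k,r]$ whenever $l,m\in L$, $k,r\in K$ with $k+Z(K)=\alpha(l+Z(L))$ and $r+Z(K)=\alpha(m+Z(L))$. Isoclinism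 is an equivalence relation. *)

theory Defs
  imports "Jordan_Normal_Form.Missing_VectorSpace" "HOL-Library.Z2" "HOL-Library.Extended_Nat"
    "HOL-Algebra.QuotRing"
begin

hide_const (open) Multiset.mult

definition ring_char :: "('f, 'm) ring_scheme \<Rightarrow> nat" where
  "ring_char F =
     (if \<exists>n::nat. n > 0 \<and> [n] \<cdot>\<^bsub>F\<^esub> \<one>\<^bsub>F\<^esub> = \<zero>\<^bsub>F\<^esub>
      then (LEAST n::nat. n > 0 \<and> [n] \<cdot>\<^bsub>F\<^esub> \<one>\<^bsub>F\<^esub> = \<zero>\<^bsub>F\<^esub>) else 0)"

text \<open>The library's \<open>dim\<close> is a natural number that is meaningful for finite-dimensional spaces only.\<close>

definition edim :: "('f, 'm) ring_scheme \<Rightarrow> ('f, 'a, 'n) module_scheme \<Rightarrow> enat" where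
  "edim F V = (if vectorspace.fin_dim F V then enat (vectorspace.dim F V) else \<infinity>)"


section \<open>Lie superalgebras\<close>

text \<open>Parities are elements of the two-element field \<open>bit\<close>. The fields \<open>mult\<close> and \<open>one\<close>
  that the record \<open>module\<close> inherits from \<open>ring\<close> are unused here, as they are in the library locales
  \<open>module\<close> and \<open>vectorspace\<close>.\<close>

record ('f, 'a) superalgebra = "('f, 'a) module" +
  grade :: "bit \<Rightarrow> 'a set"
  bracket :: "'a \<Rightarrow> 'a \<Rightarrow> 'a"  (\<open>\<lbrace>_, _\<rbrace>\<index>\<close>)

text \<open>The sign \<open>(-1)\<close> to the power \<open>p q\<close>, as a scalar.\<close>

definition koszul_sign :: "('f, 'm) ring_scheme \<Rightarrow> bit \<Rightarrow> bit \<Rightarrow> 'f" where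
  "koszul_sign F p q = (if p = 1 \<and> q = 1 then \<ominus>\<^bsub>F\<^esub> \<one>\<^bsub>F\<^esub> else \<one>\<^bsub>F\<^esub>)"

locale lie_superalgebra = vectorspace F L
  for F :: "('f, 'm) ring_scheme" and L :: "('f, 'a) superalgebra" (structure) +
  assumes grade_subspace: "VectorSpace.subspace F (grade L p) L"
    and grade_sum: "carrier L = grade L 0 <+>\<^bsub>L\<^esub> grade L 1"
    and grade_disjoint: "grade L 0 \<inter> grade L 1 = {\<zero>}"
    and bracket_closed: "\<lbrakk>x \<in> carrier L; y \<in> carrier L\<rbrakk> \<Longrightarrow> \<lbrace>x, y\<rbrace> \<in> carrier L"
    and bracket_add_left: "\<lbrakk>x \<in> carrier L; y \<in> carrier L; z \<in> carrier L\<rbrakk>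
          \<Longrightarrow> \<lbrace>x \<oplus> y, z\<rbrace> = \<lbrace>x, z\<rbrace> \<oplus> \<lbrace>y, z\<rbrace>"
    and bracket_add_right: "\<lbrakk>x \<in> carrier L; y \<in> carrier L; z \<in> carrier L\<rbrakk>
          \<Longrightarrow> \<lbrace>x, y \<oplus> z\<rbrace> = \<lbrace>x, y\<rbrace> \<oplus> \<lbrace>x, z\<rbrace>"
    and bracket_smult_left: "\<lbrakk>c \<in> carrier F; x \<in> carrier L; y \<in> carrier L\<rbrakk>
          \<Longrightarrow> \<lbrace>c \<odot> x, y\<rbrace> = c \<odot> \<lbrace>x, y\<rbrace>"
    and bracket_smult_right: "\<lbrakk>c \<in> carrier F; x \<in> carrier L; y \<in> carrier L\<rbrakk>
          \<Longrightarrow> \<lbrace>x, c \<odot> y\<rbrace> = c \<odot> \<lbrace>x, y\<rbrace>"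
    and bracket_grade: "\<lbrakk>x \<in> grade L p; y \<in> grade L q\<rbrakk> \<Longrightarrow> \<lbrace>x, y\<rbrace> \<in> grade L (p + q)"
    and super_skew: "\<lbrakk>x \<in> grade L p; y \<in> grade L q\<rbrakk>
          \<Longrightarrow> \<lbrace>x, y\<rbrace> = \<ominus> (koszul_sign F p q \<odot> \<lbrace>y, x\<rbrace>)"
    and super_jacobi: "\<lbrakk>x \<in> grade L p; y \<in> grade L q; z \<in> grade L r\<rbrakk>
          \<Longrightarrow> koszul_sign F p r \<odot> \<lbrace>x, \<lbrace>y, z\<rbrace>\<rbrace> \<oplus> koszul_sign F q p \<odot> \<lbrace>y, \<lbrace>z, x\<rbrace>\<rbrace>
              \<oplus> koszul_sign F r q \<odot> \<lbrace>z, \<lbrace>x, y\<rbrace>\<rbrace> = \<zero>"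

definition super_iso ::
  "('f, 'm) ring_scheme \<Rightarrow> ('f, 'a) superalgebra \<Rightarrow> ('f, 'b) superalgebra \<Rightarrow> ('a \<Rightarrow> 'b) set" where
  "super_iso F L K = {f. f \<in> LinearCombinations.module_hom F L K
     \<and> (\<forall>p. f ` grade L p \<subseteq> grade K p)
     \<and> (\<forall>x\<in>carrier L. \<forall>y\<in>carrier L. f \<lbrace>x, y\<rbrace>\<^bsub>L\<^esub> = \<lbrace>f x, f y\<rbrace>\<^bsub>K\<^esub>)
     \<and> bij_betw f (carrier L) (carrier K)}"

definition center :: "('f, 'a) superalgebra \<Rightarrow> 'a set" where
  "center L = {z \<in> carrier L. \<forall>x\<in>carrier L. \<lbrace>z, x\<rbrace>\<^bsub>L\<^esub> = \<zero>\<^bsub>L\<^esub>}"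

definition derived_set :: "('f, 'm) ring_scheme \<Rightarrow> ('f, 'a) superalgebra \<Rightarrow> 'a set" where
  "derived_set F L = LinearCombinations.module.span F L {\<lbrace>x, y\<rbrace>\<^bsub>L\<^esub> | x y. x \<in> carrier L \<and> y \<in> carrier L}"

definition derived :: "('f, 'm) ring_scheme \<Rightarrow> ('f, 'a) superalgebra \<Rightarrow> ('f, 'a) superalgebra" where
  "derived F L = L \<lparr>carrier := derived_set F L, grade := \<lambda>p. grade L p \<inter> derived_set F L\<rparr>"

text \<open>Operations on cosets follow the library's \<open>FactRing\<close>: for a graded ideal \<open>I\<close> each of
  the unions below is a single coset.\<close>

definition super_quot :: "('f, 'a) superalgebra \<Rightarrow> 'a set \<Rightarrow> ('f, 'a set) superalgebra" where
  "super_quot L I =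
     \<lparr>carrier = a_rcosets\<^bsub>L\<^esub> I, mult = undefined, one = undefined, zero = I, add = set_add L,
      smult = (\<lambda>c A. \<Union>a\<in>A. I +>\<^bsub>L\<^esub> (c \<odot>\<^bsub>L\<^esub> a)),
      grade = (\<lambda>p. (\<lambda>x. I +>\<^bsub>L\<^esub> x) ` grade L p),
      bracket = (\<lambda>A B. \<Union>a\<in>A. \<Union>b\<in>B. I +>\<^bsub>L\<^esub> \<lbrace>a, b\<rbrace>\<^bsub>L\<^esub>)\<rparr>"

definition stem :: "('f, 'm) ring_scheme \<Rightarrow> ('f, 'a) superalgebra \<Rightarrow> bool" where
  "stem F L \<longleftrightarrow> center L \<subseteq> derived_set F L"


section \<open>Isoclinism\<close>

definition isoclinic ::
  "('f, 'm) ring_scheme \<Rightarrow> ('f, 'a) superalgebra \<Rightarrow> ('f, 'b) superalgebra \<Rightarrow> bool" where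
  "isoclinic F L K \<longleftrightarrow>
     (\<exists>\<alpha> \<in> super_iso F (super_quot L (center L)) (super_quot K (center K)).
      \<exists>\<beta> \<in> super_iso F (derived F L) (derived F K).
        \<forall>l\<in>carrier L. \<forall>m\<in>carrier L. \<forall>k\<in>carrier K. \<forall>r\<in>carrier K.
          center K +>\<^bsub>K\<^esub> k = \<alpha> (center L +>\<^bsub>L\<^esub> l) \<longrightarrow>
          center K +>\<^bsub>K\<^esub> r = \<alpha> (center L +>\<^bsub>L\<^esub> m) \<longrightarrow>
          \<beta> \<lbrace>l, m\<rbrace>\<^bsub>L\<^esub> = \<lbrace>k, r\<rbrace>\<^bsub>K\<^esub>)"

text \<open>All Lie superalgebras over \<open>F\<close> do not form a set. The type \<open>'a\<close> plays the role
  of the universe: the underlying set of a Lie superalgebra is an arbitrary subset \<open>carrier L\<close> of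
  \<open>'a\<close>, and \<open>'a\<close> itself is arbitrary (any two Lie superalgebras, even over different types, can be
  carried over to a common one, such as a sum type).\<close>

definition isoclinism ::
  "('f, 'm) ring_scheme \<Rightarrow> (('f, 'a) superalgebra \<times> ('f, 'a) superalgebra) set" where
  "isoclinism F = {(L, K). lie_superalgebra F L \<and> lie_superalgebra F K \<and> isoclinic F L K}"

definition isoclinism_families :: "('f, 'm) ring_scheme \<Rightarrow> ('f, 'a) superalgebra set set" where
  "isoclinism_families F = {L. lie_superalgebra F L} // isoclinism F"

end

theory Submission
  imports Defs
begin

text \<open>Let \<open>Z\<close> be the center of \<open>L\<close>. Zorn's lemma, applied in each degree, gives a graded subspace \<open>W\<close>
  that is maximal among those containing \<open>L\<^sup>2\<close> and meeting \<open>Z\<close> only inside \<open>L\<^sup>2\<close>; maximality forces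
  \<open>W + Z = L\<close>. Containing \<open>L\<^sup>2\<close>, \<open>W\<close> is a subalgebra, and since it differs from \<open>L\<close> only by central
  elements it is isoclinic to \<open>L\<close>, with center \<open>W \<inter> Z \<subseteq> L\<^sup>2 = W\<^sup>2\<close>: it is stem. No quotient of \<open>L\<close> is
  needed, so \<open>W\<close> lives in the same type as \<open>L\<close>. If \<open>L\<close> is finite dimensional of minimal dimensions,
  then \<open>W = L\<close>, so \<open>L\<close> itself is stem. Conversely, if \<open>T\<close> is stem and isoclinic to \<open>L\<close>, then the two
  isomorphisms embed the central quotient of \<open>T\<close> into that of \<open>L\<close> and \<open>Z(T) \<subseteq> T\<^sup>2\<close> into \<open>Z(L)\<close>,
  degree by degree, which bounds the dimensions of \<open>T\<close>.\<close>

section \<open>Subspaces and dimension\<close>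

context vectorspace
begin

lemma submodule_Int:
  assumes "submodule K A V" "submodule K B V"
  shows "submodule K (A \<inter> B) V"
  using assms unfolding submodule_def by auto

lemma submodule_zero: "submodule K {\<zero>\<^bsub>V\<^esub>} V"
  unfolding submodule_def using module_axioms by auto

lemma submodule_minus:
  assumes "submodule K W V" "x \<in> W" "y \<in> W"
  shows "x \<ominus>\<^bsub>V\<^esub> y \<in> W"
proof -
  interpret W: submodule K W V by fact
  have "y \<in> carrier V" using assms W.subset by auto
  then have "\<ominus>\<^bsub>V\<^esub> y = (\<ominus>\<^bsub>K\<^esub> \<one>\<^bsub>K\<^esub>) \<odot>\<^bsub>V\<^esub> y" by (simp add: smult_minus_1)
  then show ?thesis using assms unfolding a_minus_def by simp
qed

text \<open>Take \<open>W\<close> maximal by Zorn's lemma. If some x of \<open>U\<close> lay outside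
  W + Z, adjoining x to \<open>W\<close> would give a larger candidate: an element w + c x of
  \<open>Z\<close> with c nonzero would put x into W + Z, and for c = 0 it lies in W \<inter> Z. For
  D = {0} the result is a complement of \<open>Z\<close> in \<open>U\<close>, in any
  dimension.\<close>

lemma maximal_submodule_complement:
  assumes U: "submodule K U V" and D: "submodule K D V" "D \<subseteq> U" and Z: "submodule K Z V" "Z \<subseteq> U"
  obtains W where "submodule K W V" "D \<subseteq> W" "W \<subseteq> U" "W \<inter> Z \<subseteq> D"
    "\<And>x. x \<in> U \<Longrightarrow> \<exists>w\<in>W. \<exists>z\<in>Z. x = w \<oplus>\<^bsub>V\<^esub> z"
proof -
  interpret U: submodule K U V by fact
  interpret Z: submodule K Z V by fact
  let ?A = "{W. submodule K W V \<and> D \<subseteq> W \<and> W \<subseteq> U \<and> W \<inter> Z \<subseteq> D}"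
  have "\<exists>M\<in>?A. \<forall>X\<in>?A. M \<subseteq> X \<longrightarrow> X = M"
  proof (rule subset_Zorn_nonempty)
    show "?A \<noteq> {}" using D by auto
  next
    fix C assume C: "C \<noteq> {}" "subset.chain ?A C"
    have "submodule K (\<Union>C) V"
    proof (rule nested_union_vs[of C "\<lambda>x. x"])
      show "\<exists>k. k \<in> C \<and> i \<subseteq> k \<and> j \<subseteq> k" if "i \<in> C" "j \<in> C" for i j
        using that C(2) unfolding subset_chain_def by (metis order_refl)
    qed (use C in \<open>auto simp: subset_chain_def\<close>)
    moreover obtain W where "W \<in> C" using C by auto
    moreover have "D \<subseteq> X \<and> X \<subseteq> U \<and> X \<inter> Z \<subseteq> D" if "X \<in> C" for X
      using that C by (auto simp: subset_chain_def)
    ultimately show "\<Union>C \<in> ?A" by blast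
  qed
  then obtain W where W: "submodule K W V" "D \<subseteq> W" "W \<subseteq> U" "W \<inter> Z \<subseteq> D"
    and max: "\<And>X. submodule K X V \<Longrightarrow> D \<subseteq> X \<Longrightarrow> X \<subseteq> U \<Longrightarrow> X \<inter> Z \<subseteq> D \<Longrightarrow> W \<subseteq> X \<Longrightarrow> X = W"
    by auto
  interpret W: submodule K W V by fact
  have "\<exists>w\<in>W. \<exists>z\<in>Z. x = w \<oplus>\<^bsub>V\<^esub> z" if x: "x \<in> U" for x
  proof (rule ccontr)
    assume no: "\<not> ?thesis"
    have xc: "x \<in> carrier V" using x U.subset by auto
    \<comment> \<open>\<open>X\<close> is the sum of \<open>W\<close> and the line through x. Once
      it is admissible, maximality gives X = W, hence x in \<open>W\<close>, against
      \<open>no\<close>.\<close>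
    define X where "X = {w \<oplus>\<^bsub>V\<^esub> c \<odot>\<^bsub>V\<^esub> x | w c. w \<in> W \<and> c \<in> carrier K}"
    have XI: "w \<oplus>\<^bsub>V\<^esub> c \<odot>\<^bsub>V\<^esub> x \<in> X" if "w \<in> W" "c \<in> carrier K" for w c
      using that unfolding X_def by auto
    have Wc: "w \<in> carrier V" if "w \<in> W" for w using that W.subset by auto
    have WX: "W \<subseteq> X"
    proof
      fix w assume w: "w \<in> W"
      then have "w = w \<oplus>\<^bsub>V\<^esub> \<zero>\<^bsub>K\<^esub> \<odot>\<^bsub>V\<^esub> x" using xc Wc by simp
      then show "w \<in> X" using XI[OF w, of "\<zero>\<^bsub>K\<^esub>"] by simp
    qed
    have "x = \<zero>\<^bsub>V\<^esub> \<oplus>\<^bsub>V\<^esub> \<one>\<^bsub>K\<^esub> \<odot>\<^bsub>V\<^esub> x" using xc by simp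
    then have xX: "x \<in> X" using XI[of "\<zero>\<^bsub>V\<^esub>" "\<one>\<^bsub>K\<^esub>"] by simp
    have "X = W"
    proof (rule max)
      show "submodule K X V"
      proof (rule LinearCombinations.submodule.intro)
        show "Module.module K V" by unfold_locales
        show "X \<subseteq> carrier V" using xc Wc unfolding X_def by auto
        show "\<zero>\<^bsub>V\<^esub> \<in> X" using WX by auto
      next
        fix v w assume "v \<in> X" "w \<in> X"
        then obtain v' c w' d where *: "v = v' \<oplus>\<^bsub>V\<^esub> c \<odot>\<^bsub>V\<^esub> x" "w = w' \<oplus>\<^bsub>V\<^esub> d \<odot>\<^bsub>V\<^esub> x"
          "v' \<in> W" "w' \<in> W" "c \<in> carrier K" "d \<in> carrier K" unfolding X_def by auto
        have "v \<oplus>\<^bsub>V\<^esub> w = (v' \<oplus>\<^bsub>V\<^esub> w') \<oplus>\<^bsub>V\<^esub> (c \<oplus>\<^bsub>K\<^esub> d) \<odot>\<^bsub>V\<^esub> x"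
          using * xc Wc by (simp add: smult_l_distr M.a_ac)
        then show "v \<oplus>\<^bsub>V\<^esub> w \<in> X" using * XI by simp
      next
        fix c v assume c: "c \<in> carrier K" and "v \<in> X"
        then obtain v' d where *: "v = v' \<oplus>\<^bsub>V\<^esub> d \<odot>\<^bsub>V\<^esub> x" "v' \<in> W" "d \<in> carrier K"
          unfolding X_def by auto
        have "c \<odot>\<^bsub>V\<^esub> v = (c \<odot>\<^bsub>V\<^esub> v') \<oplus>\<^bsub>V\<^esub> (c \<otimes>\<^bsub>K\<^esub> d) \<odot>\<^bsub>V\<^esub> x"
          using * c xc Wc by (simp add: smult_r_distr smult_assoc1)
        then show "c \<odot>\<^bsub>V\<^esub> v \<in> X" using * c XI by simp
      qed
      show "D \<subseteq> X" using W WX by auto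
      show "X \<subseteq> U" using W(3) x unfolding X_def by auto
      show "W \<subseteq> X" by (fact WX)
      show "X \<inter> Z \<subseteq> D"
      proof
        fix y assume y: "y \<in> X \<inter> Z"
        then obtain w c where *: "y = w \<oplus>\<^bsub>V\<^esub> c \<odot>\<^bsub>V\<^esub> x" "w \<in> W" "c \<in> carrier K"
          unfolding X_def by auto
        have yc: "y \<in> carrier V" using y Z.subset by auto
        show "y \<in> D"
        proof (cases "c = \<zero>\<^bsub>K\<^esub>")
          case True
          then have "y = w" using * xc Wc by simp
          then show ?thesis using * y W by auto
        next
          case False
          define d where "d = inv\<^bsub>K\<^esub> c"
          have d: "d \<in> carrier K" "d \<otimes>\<^bsub>K\<^esub> c = \<one>\<^bsub>K\<^esub>"
            using False * field_Units unfolding d_def by (auto intro: R.Units_l_inv)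
          have e: "d \<odot>\<^bsub>V\<^esub> y = (d \<odot>\<^bsub>V\<^esub> w) \<oplus>\<^bsub>V\<^esub> x"
            using * d xc Wc by (simp add: smult_r_distr smult_assoc1[symmetric])
          \<comment> \<open>Dividing by c solves for x, which exhibits it in W + Z and contradicts
            \<open>no\<close>.\<close>
          have "x = \<ominus>\<^bsub>V\<^esub> (d \<odot>\<^bsub>V\<^esub> w) \<oplus>\<^bsub>V\<^esub> d \<odot>\<^bsub>V\<^esub> y"
            unfolding e using * d xc Wc by (simp add: M.r_neg1)
          moreover have "\<ominus>\<^bsub>V\<^esub> (d \<odot>\<^bsub>V\<^esub> w) \<in> W"
            using submodule_minus[OF W(1) W.zero_closed, of "d \<odot>\<^bsub>V\<^esub> w"] * d Wc
            by (simp add: a_minus_def)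
          moreover have "d \<odot>\<^bsub>V\<^esub> y \<in> Z" using y d by auto
          ultimately show ?thesis using no by blast
        qed
      qed
    qed
    then have "x \<in> W" using xX by simp
    then show False using no xc by (metis M.r_zero Z.zero_closed)
  qed
  then show thesis using that W by blast
qed

text \<open>An infinite independent set would have finite subsets of every size, so the bound covers
  all independent sets. A maximal one then exists, is finite, and is a basis.\<close>

lemma fin_dim_if_li_bounded:
  assumes "\<And>A. finite A \<Longrightarrow> A \<subseteq> carrier V \<Longrightarrow> lin_indpt A \<Longrightarrow> card A \<le> n"
  shows "fin_dim \<and> dim \<le> n"
proof -
  let ?P = "\<lambda>S. S \<subseteq> carrier V \<and> lin_indpt S"
  have fin: "finite A \<and> card A \<le> n" if A: "?P A" for A
  proof (cases "finite A")
    case False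
    then obtain B where B: "B \<subseteq> A" "finite B" "card B = Suc n" using infinite_arbitrarily_large by blast
    then have "card B \<le> n" using assms[OF B(2)] A subset_li_is_li by blast
    then show ?thesis using B by simp
  qed (use assms A in auto)
  have "?P {}" unfolding lin_dep_def by auto
  then obtain A where A: "finite A" "maximal A ?P" using maximal_exists[of ?P n "{}"] fin by blast
  have b: "basis A" using A(2) by (rule max_li_is_basis)
  have "card A \<le> n" using fin A(2) unfolding maximal_def by auto
  then show ?thesis using dim_basis[OF A(1) b] A(1) b unfolding fin_dim_def basis_def by auto
qed

end

text \<open>A total linear relation with trivial kernel transports independent sets by choosing
  related elements.\<close>

lemma edim_le_of_linear_relation:
  fixes V :: "('f, 'a, 'n) module_scheme" and W :: "('f, 'b, 'k) module_scheme"
  assumes V: "vectorspace F V" and W: "vectorspace F W"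
    and rel: "P \<subseteq> carrier V \<times> carrier W"
    and add: "\<And>v w v' w'. (v, w) \<in> P \<Longrightarrow> (v', w') \<in> P \<Longrightarrow> (v \<oplus>\<^bsub>V\<^esub> v', w \<oplus>\<^bsub>W\<^esub> w') \<in> P"
    and smult: "\<And>c v w. c \<in> carrier F \<Longrightarrow> (v, w) \<in> P \<Longrightarrow> (c \<odot>\<^bsub>V\<^esub> v, c \<odot>\<^bsub>W\<^esub> w) \<in> P"
    and total: "\<And>v. v \<in> carrier V \<Longrightarrow> \<exists>w. (v, w) \<in> P"
    and ker: "\<And>v. (v, \<zero>\<^bsub>W\<^esub>) \<in> P \<Longrightarrow> v = \<zero>\<^bsub>V\<^esub>"
  shows "edim F V \<le> edim F W"
proof (cases "vectorspace.fin_dim F W")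
  case False
  then show ?thesis by (simp add: edim_def)
next
  case True
  interpret V: vectorspace F V by fact
  interpret W: vectorspace F W by fact
  \<comment> \<open>The choice \<open>g\<close> need not be linear. Linearity is recovered in
    \<open>comb\<close>, which relates a combination of vectors to the same combination of their
    chosen partners.\<close>
  define g where "g v = (SOME w. (v, w) \<in> P)" for v
  have g: "(v, g v) \<in> P" if "v \<in> carrier V" for v
    unfolding g_def using total[OF that] by (rule someI_ex)
  then have gc: "g v \<in> carrier W" if "v \<in> carrier V" for v using that rel by auto
  \<comment> \<open>Totality provides some partner of zero; scaling the pair by the zero scalar
    turns it into (0, 0).\<close>
  obtain w where "(\<zero>\<^bsub>V\<^esub>, w) \<in> P" using total by blast
  then have "(\<zero>\<^bsub>F\<^esub> \<odot>\<^bsub>V\<^esub> \<zero>\<^bsub>V\<^esub>, \<zero>\<^bsub>F\<^esub> \<odot>\<^bsub>W\<^esub> w) \<in> P" "w \<in> carrier W"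
    using smult[OF V.R.zero_closed] rel by blast+
  then have zero: "(\<zero>\<^bsub>V\<^esub>, \<zero>\<^bsub>W\<^esub>) \<in> P" by simp
  have comb: "(V.lincomb a A, \<Oplus>\<^bsub>W\<^esub>v\<in>A. a v \<odot>\<^bsub>W\<^esub> g v) \<in> P"
    if "finite A" "A \<subseteq> carrier V" "a \<in> A \<rightarrow> carrier F" for a A
    using that
  proof (induction A rule: finite_induct)
    case empty
    then show ?case using zero by (simp add: V.lincomb_def)
  next
    case (insert x A)
    have "V.lincomb a (insert x A) = a x \<odot>\<^bsub>V\<^esub> x \<oplus>\<^bsub>V\<^esub> V.lincomb a A"
      using insert V.lincomb_insert2[of A a x] by auto
    moreover have "(\<Oplus>\<^bsub>W\<^esub>v\<in>insert x A. a v \<odot>\<^bsub>W\<^esub> g v) = a x \<odot>\<^bsub>W\<^esub> g x \<oplus>\<^bsub>W\<^esub> (\<Oplus>\<^bsub>W\<^esub>v\<in>A. a v \<odot>\<^bsub>W\<^esub> g v)"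
      using insert gc by (subst W.M.finsum_insert) (auto simp: Pi_iff subset_iff)
    ultimately show ?case using insert by (auto intro!: add smult g)
  qed
  have "card A \<le> W.dim" if A: "finite A" "A \<subseteq> carrier V" "V.lin_indpt A" for A
  proof -
    have inj: "inj_on g A"
    proof
      fix x y assume xy: "x \<in> A" "y \<in> A" "g x = g y"
      then have c: "x \<in> carrier V" "y \<in> carrier V" using A by auto
      have "((\<ominus>\<^bsub>F\<^esub> \<one>\<^bsub>F\<^esub>) \<odot>\<^bsub>V\<^esub> y, (\<ominus>\<^bsub>F\<^esub> \<one>\<^bsub>F\<^esub>) \<odot>\<^bsub>W\<^esub> g y) \<in> P" using g c smult by simp
      then have "(x \<oplus>\<^bsub>V\<^esub> \<ominus>\<^bsub>V\<^esub> y, g x \<oplus>\<^bsub>W\<^esub> \<ominus>\<^bsub>W\<^esub> g y) \<in> P"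
        using c g gc add by (simp add: V.smult_minus_1 W.smult_minus_1)
      then have "x \<ominus>\<^bsub>V\<^esub> y = \<zero>\<^bsub>V\<^esub>" using xy c gc ker by (simp add: a_minus_def W.M.r_neg)
      then show "x = y" using c by simp
    qed
    have "W.lin_indpt (g ` A)"
    proof (rule W.finite_lin_indpt2)
      show "finite (g ` A)" "g ` A \<subseteq> carrier W" using A gc by auto
    next
      fix a assume a: "a \<in> g ` A \<rightarrow> carrier F" "W.lincomb a (g ` A) = \<zero>\<^bsub>W\<^esub>"
      have "W.lincomb a (g ` A) = (\<Oplus>\<^bsub>W\<^esub>v\<in>A. (a \<circ> g) v \<odot>\<^bsub>W\<^esub> g v)"
        unfolding W.lincomb_def using inj a A gc
        by (subst W.M.finsum_reindex) (auto simp: Pi_iff)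
      \<comment> \<open>By \<open>comb\<close> the combination of \<open>A\<close> is related to the
        vanishing combination of the images, so the kernel condition makes it zero.\<close>
      then have "V.lincomb (a \<circ> g) A = \<zero>\<^bsub>V\<^esub>"
        using comb[OF A(1,2), of "a \<circ> g"] a ker by (auto simp: Pi_iff)
      then have "(a \<circ> g) v = \<zero>\<^bsub>F\<^esub>" if "v \<in> A" for v
        using that A a V.lin_dep_crit[OF A(1) order_refl, of "a \<circ> g" v] by (auto simp: Pi_iff)
      then show "\<forall>v\<in>g ` A. a v = \<zero>\<^bsub>F\<^esub>" by auto
    qed
    then have "card (g ` A) \<le> W.dim" using A gc True by (intro W.li_le_dim(2)) auto
    then show ?thesis using inj by (simp add: card_image)
  qed
  then have "V.fin_dim \<and> V.dim \<le> W.dim" by (rule V.fin_dim_if_li_bounded)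
  then show ?thesis using True by (simp add: edim_def)
qed

lemma (in vectorspace) submodule_vs:
  assumes "submodule K W V"
  shows "vectorspace K (V\<lparr>carrier := W\<rparr>)"
  by (rule subspace_is_vs, rule subspace.intro) (fact vectorspace_axioms, fact assms)

text \<open>The inclusion is used as a diagonal relation. The two records may differ in further
  components, such as the grading, which allows comparing graded parts of
  \<open>restrict_super L W\<close> with subspaces of \<open>L\<close>.\<close>

lemma edim_mono:
  fixes V W :: "('f, 'a, 'n) module_scheme"
  assumes "vectorspace F V" "vectorspace F W" "carrier V \<subseteq> carrier W"
    and "zero V = zero W" "add V = add W" "smult V = smult W"
  shows "edim F V \<le> edim F W"
proof (rule edim_le_of_linear_relation)
  interpret V: vectorspace F V by fact
  let ?P = "(\<lambda>x. (x, x)) ` carrier V"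
  show "(v \<oplus>\<^bsub>V\<^esub> v', w \<oplus>\<^bsub>W\<^esub> w') \<in> ?P" if "(v, w) \<in> ?P" "(v', w') \<in> ?P" for v w v' w'
    using that assms(5)[symmetric] by auto
  show "(c \<odot>\<^bsub>V\<^esub> v, c \<odot>\<^bsub>W\<^esub> w) \<in> ?P" if "c \<in> carrier F" "(v, w) \<in> ?P" for c v w
    using that assms(6)[symmetric] by auto
qed (use assms in auto)

text \<open>Finite dimension of the whole space turns \<open>le\<close> into an inequality of
  natural numbers. A basis of \<open>A\<close> is then an independent subset of \<open>B\<close>
  with at least dim B elements, so it spans \<open>B\<close>.\<close>

lemma (in vectorspace) submodule_eq_if_edim_le:
  assumes fin: "fin_dim" and A: "submodule K A V" and B: "submodule K B V" and "A \<subseteq> B"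
    and le: "edim K (V\<lparr>carrier := B\<rparr>) \<le> edim K (V\<lparr>carrier := A\<rparr>)"
  shows "A = B"
proof -
  interpret A: vectorspace K "V\<lparr>carrier := A\<rparr>" using A by (rule submodule_vs)
  interpret B: vectorspace K "V\<lparr>carrier := B\<rparr>" using B by (rule submodule_vs)
  have "edim K (V\<lparr>carrier := A\<rparr>) \<le> edim K V" "edim K (V\<lparr>carrier := B\<rparr>) \<le> edim K V"
    using submodule.subset[OF A] submodule.subset[OF B]
    by (auto intro!: edim_mono A.vectorspace_axioms B.vectorspace_axioms vectorspace_axioms)
  then have fd: "A.fin_dim" "B.fin_dim"
    using fin by (auto simp: edim_def split: if_splits)
  then have d: "B.dim \<le> A.dim" using le by (simp add: edim_def)
  obtain S where S: "finite S" "A.basis S" using A.finite_basis_exists[OF fd(1)] by auto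
  then have SA: "S \<subseteq> A" "A.span S = A" "A.lin_indpt S" unfolding A.basis_def by auto
  have sp: "A.span S = span S" "B.span S = span S" "A.lin_dep S = lin_dep S" "B.lin_dep S = lin_dep S"
    using span_li_not_depend[OF SA(1) A] span_li_not_depend[of S B] SA(1) B \<open>A \<subseteq> B\<close> by auto
  have "B.basis S"
  proof (rule B.dim_li_is_basis)
    show "card S \<ge> B.dim" using d A.dim_basis[OF S] by simp
  qed (use S SA sp fd \<open>A \<subseteq> B\<close> in auto)
  then show ?thesis unfolding B.basis_def using SA sp by auto
qed

section \<open>Homogeneous subspaces\<close>

text \<open>Common form of \<open>derived\<close> and of the stem subalgebra built below. It is a
  Lie superalgebra when \<open>W\<close> is a graded subspace closed under the bracket.\<close>

definition restrict_super :: "('f, 'a) superalgebra \<Rightarrow> 'a set \<Rightarrow> ('f, 'a) superalgebra" where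
  "restrict_super L W = L\<lparr>carrier := W, grade := \<lambda>p. grade L p \<inter> W\<rparr>"

lemma restrict_super_simps [simp]:
  "carrier (restrict_super L W) = W"
  "zero (restrict_super L W) = zero L"
  "add (restrict_super L W) = add L"
  "smult (restrict_super L W) = smult L"
  "bracket (restrict_super L W) = bracket L"
  "grade (restrict_super L W) = (\<lambda>p. grade L p \<inter> W)"
  by (simp_all add: restrict_super_def)

lemma derived_eq_restrict_super: "derived F L = restrict_super L (derived_set F L)"
  by (simp add: derived_def restrict_super_def)

text \<open>The module axioms see only these four components of the record, so they pass from a mere
  change of carrier to \<open>restrict_super\<close>, which also changes the grading.\<close>

lemma module_cong:
  fixes M N :: "('f, 'a, 'n) module_scheme"
  assumes "carrier M = carrier N" "zero M = zero N" "add M = add N" "smult M = smult N"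
  shows "Module.module F M \<longleftrightarrow> Module.module F N"
  using assms
  by (simp add: Module.module_def Module.module_axioms_def abelian_group_def abelian_monoid_def
      abelian_group_axioms_def)

context lie_superalgebra
begin

lemma grade_submodule: "submodule F (grade L p) L"
  using grade_subspace by (rule is_module)

lemma grade_closed [simp]: "x \<in> grade L p \<Longrightarrow> x \<in> carrier L"
  using submodule.subset[OF grade_submodule] by blast

text \<open>In \<open>bit\<close> the sum p + 1 is the opposite parity, so one statement serves both
  degrees.\<close>

lemma decompose:
  assumes "x \<in> carrier L"
  obtains u v where "u \<in> grade L p" "v \<in> grade L (p + 1)" "x = u \<oplus> v"
proof -
  obtain u v where uv: "u \<in> grade L 0" "v \<in> grade L 1" "x = u \<oplus> v"
    using assms grade_sum unfolding set_add_def' by auto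
  show thesis
  proof (cases p)
    case zero
    then show thesis using that uv by simp
  next
    case one
    then show thesis using that[of v u] uv by (simp add: M.a_comm)
  qed
qed

lemma grade_Int: "x \<in> grade L p \<Longrightarrow> x \<in> grade L (p + 1) \<Longrightarrow> x = \<zero>"
  using grade_disjoint by (cases p) auto

text \<open>The element u - u' = v' - v lies in both degrees, which meet only in zero.\<close>

lemma grade_sum_unique:
  assumes "u \<in> grade L p" "v \<in> grade L (p + 1)" "u' \<in> grade L p" "v' \<in> grade L (p + 1)"
    and eq: "u \<oplus> v = u' \<oplus> v'"
  shows "u = u' \<and> v = v'"
proof -
  have c: "u \<in> carrier L" "v \<in> carrier L" "u' \<in> carrier L" "v' \<in> carrier L" using assms by auto
  have "u \<ominus> u' = \<ominus> u' \<oplus> u" using c by (simp add: a_minus_def M.a_comm)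
  also have "\<dots> = \<ominus> u' \<oplus> (u \<oplus> v) \<oplus> \<ominus> v" using c by (simp add: M.a_assoc M.r_neg)
  also have "\<dots> = v' \<ominus> v"
    unfolding eq using c by (simp add: a_minus_def M.a_assoc M.r_neg1 M.r_neg2)
  finally have e: "u \<ominus> u' = v' \<ominus> v" .
  have "u \<ominus> u' \<in> grade L p" "v' \<ominus> v \<in> grade L (p + 1)"
    using assms submodule_minus[OF grade_submodule] by auto
  then have "u \<ominus> u' = \<zero>" "v' \<ominus> v = \<zero>" using e grade_Int by auto
  then show ?thesis using c by auto
qed

lemma zero_in_grade [simp]: "\<zero> \<in> grade L p"
  using submodule.zero_closed[OF grade_submodule] .

lemma grade_sum_zero:
  assumes "u \<in> grade L p" "v \<in> grade L (p + 1)" "u \<oplus> v = \<zero>"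
  shows "u = \<zero> \<and> v = \<zero>"
  using grade_sum_unique[OF assms(1,2), of \<zero> \<zero>] assms(3) by simp

text \<open>Graded subspaces: equivalently, \<open>W\<close> is the sum of its intersections with
  the two degrees.\<close>

definition homogeneous :: "'a set \<Rightarrow> bool" where
  "homogeneous W \<longleftrightarrow> submodule F W L \<and> (\<forall>u\<in>grade L 0. \<forall>v\<in>grade L 1. u \<oplus> v \<in> W \<longrightarrow> u \<in> W \<and> v \<in> W)"

lemma homogeneous_submodule: "homogeneous W \<Longrightarrow> submodule F W L"
  by (simp add: homogeneous_def)

lemma homogeneousD:
  assumes "homogeneous W" "u \<in> grade L p" "v \<in> grade L (p + 1)" "u \<oplus> v \<in> W"
  shows "u \<in> W \<and> v \<in> W"
proof (cases p)
  case zero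
  then show ?thesis using assms by (simp add: homogeneous_def)
next
  case one
  then have "v \<oplus> u \<in> W" using assms by (metis M.a_comm grade_closed)
  then show ?thesis using assms one by (simp add: homogeneous_def)
qed

section \<open>The center as a graded subspace\<close>

lemma bracket_zero_left [simp]: "x \<in> carrier L \<Longrightarrow> \<lbrace>\<zero>, x\<rbrace> = \<zero>"
  using bracket_smult_left[of "\<zero>\<^bsub>F\<^esub>" \<zero> x] by (simp add: bracket_closed)

lemma centerI:
  "z \<in> carrier L \<Longrightarrow> (\<And>x. x \<in> carrier L \<Longrightarrow> \<lbrace>z, x\<rbrace> = \<zero>) \<Longrightarrow> z \<in> center L"
  by (simp add: center_def)

lemma center_closed [simp]: "z \<in> center L \<Longrightarrow> z \<in> carrier L"
  unfolding center_def by blast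

lemma center_bracket_left [simp]: "z \<in> center L \<Longrightarrow> x \<in> carrier L \<Longrightarrow> \<lbrace>z, x\<rbrace> = \<zero>"
  unfolding center_def by blast

lemma center_submodule: "submodule F (center L) L"
proof (rule LinearCombinations.submodule.intro)
  show "Module.module F L" by unfold_locales
  show "center L \<subseteq> carrier L" by auto
  show "\<zero> \<in> center L" by (rule centerI) simp_all
  show "v \<oplus> w \<in> center L" if "v \<in> center L" "w \<in> center L" for v w
    using that by (intro centerI) (simp_all add: bracket_add_left)
  show "c \<odot> v \<in> center L" if "c \<in> carrier F" "v \<in> center L" for c v
    using that by (intro centerI) (simp_all add: bracket_smult_left)
qed

text \<open>Bracketing with a homogeneous x sends the two components of a central element into
  different degrees. The brackets add up to zero, so each vanishes.\<close>

lemma center_homogeneous: "homogeneous (center L)"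
  unfolding homogeneous_def
proof (intro conjI ballI impI)
  show "submodule F (center L) L" by (fact center_submodule)
next
  fix u v assume u: "u \<in> grade L 0" and v: "v \<in> grade L 1" and uv: "u \<oplus> v \<in> center L"
  have *: "\<lbrace>u, x\<rbrace> = \<zero> \<and> \<lbrace>v, x\<rbrace> = \<zero>" if x: "x \<in> grade L q" for x q
  proof (rule grade_sum_zero)
    show "\<lbrace>u, x\<rbrace> \<in> grade L q" "\<lbrace>v, x\<rbrace> \<in> grade L (q + 1)"
      using bracket_grade[OF u x] bracket_grade[OF v x] by (cases q; simp)+
    show "\<lbrace>u, x\<rbrace> \<oplus> \<lbrace>v, x\<rbrace> = \<zero>"
      using u v x uv by (simp add: bracket_add_left[symmetric])
  qed
  have "\<lbrace>u, x\<rbrace> = \<zero> \<and> \<lbrace>v, x\<rbrace> = \<zero>" if x: "x \<in> carrier L" for x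
  proof -
    obtain a b where "a \<in> grade L 0" "b \<in> grade L (0 + 1)" "x = a \<oplus> b" using decompose[OF x, of 0] .
    then show ?thesis using *[of a] *[of b] u v by (simp add: bracket_add_right)
  qed
  then show "u \<in> center L" "v \<in> center L" using u v by (auto intro: centerI)
qed

text \<open>The definition of \<open>center\<close> concerns brackets with z on the left. For
  homogeneous elements super skew-symmetry reverses the bracket, and the components of z are again
  central.\<close>

lemma center_bracket_right [simp]:
  assumes z: "z \<in> center L" and x: "x \<in> carrier L"
  shows "\<lbrace>x, z\<rbrace> = \<zero>"
proof -
  have *: "\<lbrace>b, a\<rbrace> = \<zero>" if a: "a \<in> grade L p" "a \<in> center L" and b: "b \<in> grade L q" for a b p q
    using super_skew[OF b a(1)] a b
    by (auto simp: koszul_sign_def)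
  obtain u v where uv: "u \<in> grade L 0" "v \<in> grade L (0 + 1)" "z = u \<oplus> v"
    using decompose[of z 0] z by auto
  obtain a b where ab: "a \<in> grade L 0" "b \<in> grade L (0 + 1)" "x = a \<oplus> b" using decompose[OF x, of 0] .
  have "u \<in> center L \<and> v \<in> center L" using homogeneousD[OF center_homogeneous] uv z by auto
  then have "\<lbrace>a, u\<rbrace> = \<zero>" "\<lbrace>a, v\<rbrace> = \<zero>" "\<lbrace>b, u\<rbrace> = \<zero>" "\<lbrace>b, v\<rbrace> = \<zero>"
    using uv ab * by blast+
  then show ?thesis using uv ab by (simp add: bracket_add_left bracket_add_right bracket_closed)
qed

section \<open>The derived subspace and sums of subspaces of the two degrees\<close>

abbreviation "brackets \<equiv> {\<lbrace>x, y\<rbrace> | x y. x \<in> carrier L \<and> y \<in> carrier L}"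

lemma brackets_closed: "brackets \<subseteq> carrier L"
  by (auto simp: bracket_closed)

lemma derived_submodule: "submodule F (derived_set F L) L"
  unfolding derived_set_def using brackets_closed by (rule span_is_submodule)

lemma derived_closed [simp]: "x \<in> derived_set F L \<Longrightarrow> x \<in> carrier L"
  using submodule.subset[OF derived_submodule] by blast

lemma bracket_in_derived: "x \<in> carrier L \<Longrightarrow> y \<in> carrier L \<Longrightarrow> \<lbrace>x, y\<rbrace> \<in> derived_set F L"
  unfolding derived_set_def using in_own_span[OF brackets_closed] by blast

lemma derived_set_subset:
  assumes "submodule F W L" "\<And>x y. x \<in> carrier L \<Longrightarrow> y \<in> carrier L \<Longrightarrow> \<lbrace>x, y\<rbrace> \<in> W"
  shows "derived_set F L \<subseteq> W"
  unfolding derived_set_def using assms by (intro span_is_subset) auto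

text \<open>Any two subspaces chosen inside the two degrees assemble to a graded subspace having
  exactly them as its graded parts. This joins the results of separate constructions in each
  degree.\<close>

lemma homogeneous_sum:
  assumes W: "\<And>p. submodule F (W p) L" "\<And>p. W p \<subseteq> grade L p"
  defines "S \<equiv> {u \<oplus> v | u v. u \<in> W 0 \<and> v \<in> W 1}"
  shows "homogeneous S" "\<And>p. grade L p \<inter> S = W p"
proof -
  interpret W: submodule F "W p" L for p by fact
  have Wg: "x \<in> grade L p" if "x \<in> W p" for x p using W(2) that by auto
  have SI: "u \<oplus> v \<in> S" if "u \<in> W 0" "v \<in> W 1" for u v using that by (auto simp: S_def)
  have WS: "W p \<subseteq> S" for p
  proof
    fix x assume x: "x \<in> W p"
    then have xc: "x \<in> carrier L" using Wg grade_closed by blast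
    show "x \<in> S"
      using SI[of x \<zero>] SI[of \<zero> x] x xc by (cases p) auto
  qed
  have comp: "u \<in> W 0 \<and> v \<in> W 1" if uv: "u \<in> grade L 0" "v \<in> grade L 1" "u \<oplus> v \<in> S" for u v
  proof -
    obtain u' v' where *: "u' \<in> W 0" "v' \<in> W 1" "u \<oplus> v = u' \<oplus> v'" using uv by (auto simp: S_def)
    then have "u = u' \<and> v = v'" using uv Wg grade_sum_unique[of u 0 v u' v'] by simp
    then show ?thesis using * by simp
  qed
  show "homogeneous S"
    unfolding homogeneous_def
  proof (intro conjI ballI impI)
    show "submodule F S L"
    proof (rule LinearCombinations.submodule.intro)
      show "Module.module F L" by unfold_locales
      show "S \<subseteq> carrier L" using W.subset by (fastforce simp: S_def)
      show "\<zero> \<in> S" using WS W.zero_closed by blast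
    next
      fix x y assume "x \<in> S" "y \<in> S"
      then obtain u v u' v' where *: "x = u \<oplus> v" "y = u' \<oplus> v'" "u \<in> W 0" "u' \<in> W 0" "v \<in> W 1" "v' \<in> W 1"
        by (auto simp: S_def)
      have "u \<in> carrier L" "v \<in> carrier L" "u' \<in> carrier L" "v' \<in> carrier L"
        using * W.subset by auto
      then have "x \<oplus> y = (u \<oplus> u') \<oplus> (v \<oplus> v')" using * by (simp add: M.a_ac)
      then show "x \<oplus> y \<in> S" using * SI by simp
    next
      fix c x assume c: "c \<in> carrier F" and "x \<in> S"
      then obtain u v where *: "x = u \<oplus> v" "u \<in> W 0" "v \<in> W 1" by (auto simp: S_def)
      have "u \<in> carrier L" "v \<in> carrier L" using * W.subset by auto
      then have "c \<odot> x = c \<odot> u \<oplus> c \<odot> v" using * c by (simp add: smult_r_distr)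
      then show "c \<odot> x \<in> S" using * c SI by simp
    qed
  qed (use comp WS in blast)+
  show "grade L p \<inter> S = W p" for p
  proof
    show "W p \<subseteq> grade L p \<inter> S" using W(2) WS by auto
    show "grade L p \<inter> S \<subseteq> W p"
    proof
      fix x assume x: "x \<in> grade L p \<inter> S"
      show "x \<in> W p"
      proof (cases p)
        case zero
        then show ?thesis using comp[of x \<zero>] x by simp
      next
        case one
        then show ?thesis using comp[of \<zero> x] x by simp
      qed
    qed
  qed
qed

lemma homogeneous_decompose:
  assumes "homogeneous W" "x \<in> W"
  obtains u v where "u \<in> grade L p \<inter> W" "v \<in> grade L (p + 1) \<inter> W" "x = u \<oplus> v"
proof -
  have "x \<in> carrier L" using assms submodule.subset[OF homogeneous_submodule] by blast
  then obtain u v where "u \<in> grade L p" "v \<in> grade L (p + 1)" "x = u \<oplus> v" using decompose by blast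
  then show thesis using that homogeneousD[OF assms(1)] assms(2) by blast
qed

text \<open>The sum of the graded parts of \<open>derived_set F L\<close> is a subspace. It contains
  every bracket, because brackets of homogeneous elements are homogeneous, so it exhausts the
  span.\<close>

lemma derived_homogeneous: "homogeneous (derived_set F L)"
proof -
  let ?D = "derived_set F L"
  let ?W = "\<lambda>p. grade L p \<inter> ?D"
  let ?S = "{u \<oplus> v | u v. u \<in> ?W 0 \<and> v \<in> ?W 1}"
  have W: "submodule F (?W p) L" for p
    using grade_submodule derived_submodule by (rule submodule_Int)
  have S: "homogeneous ?S" "grade L p \<inter> ?S = ?W p" for p
    using homogeneous_sum[of ?W] W by auto
  have "?S \<subseteq> ?D" using submodule.m_closed[OF derived_submodule] by auto
  moreover have "?D \<subseteq> ?S"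
  proof (rule derived_set_subset)
    show sub: "submodule F ?S L" using S by (simp add: homogeneous_def)
    fix x y assume "x \<in> carrier L" "y \<in> carrier L"
    then obtain a b c d where *: "a \<in> grade L 0" "b \<in> grade L (0 + 1)" "x = a \<oplus> b"
      "c \<in> grade L 0" "d \<in> grade L (0 + 1)" "y = c \<oplus> d" using decompose[of x 0] decompose[of y 0] by metis
    have br: "\<lbrace>u, v\<rbrace> \<in> ?S" if "u \<in> grade L p" "v \<in> grade L q" for u v p q
      using S(2)[of "p + q"] bracket_grade[OF that] bracket_in_derived[of u v] that by auto
    have "\<lbrace>x, y\<rbrace> = (\<lbrace>a, c\<rbrace> \<oplus> \<lbrace>a, d\<rbrace>) \<oplus> (\<lbrace>b, c\<rbrace> \<oplus> \<lbrace>b, d\<rbrace>)"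
      using * by (simp add: bracket_add_left bracket_add_right bracket_closed M.a_ac)
    then show "\<lbrace>x, y\<rbrace> \<in> ?S"
      using br * by (simp only:) (intro submodule.m_closed[OF sub] br)
  qed
  ultimately show ?thesis using S by simp
qed

section \<open>Graded subalgebras\<close>

lemma lie_superalgebra_restrict_super:
  assumes W: "homogeneous W" and br: "\<And>x y. x \<in> W \<Longrightarrow> y \<in> W \<Longrightarrow> \<lbrace>x, y\<rbrace> \<in> W"
  shows "lie_superalgebra F (restrict_super L W)"
proof -
  let ?L = "restrict_super L W"
  have sub: "submodule F W L" using W by (simp add: homogeneous_def)
  interpret W: submodule F W L by fact
  have Wc: "x \<in> carrier L" if "x \<in> W" for x using that W.subset by auto
  have "Module.module F (L\<lparr>carrier := W\<rparr>)" using submodule_vs[OF sub] by (simp add: vectorspace_def)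
  then have mod: "Module.module F ?L"
    by (subst module_cong[where N="L\<lparr>carrier := W\<rparr>"]) simp_all
  then interpret W: vectorspace F ?L
    using field_axioms by (simp add: vectorspace_def)
  \<comment> \<open>The additive inverse is sought within the carrier, so it might change with the
    carrier. Scaling by -1 is the same operation in both structures and identifies the two
    inverses.\<close>
  have neg: "\<ominus>\<^bsub>?L\<^esub> x = \<ominus> x" if "x \<in> W" for x
    using W.smult_minus_1[of x] smult_minus_1[of x] that Wc by simp
  have koszul: "koszul_sign F p q \<in> carrier F" for p q by (simp add: koszul_sign_def)
  show ?thesis
  proof (intro lie_superalgebra.intro W.vectorspace_axioms lie_superalgebra_axioms.intro)
    fix p
    have "submodule F (grade L p \<inter> W) L" using submodule_Int[OF grade_submodule sub] .
    then show "VectorSpace.subspace F (grade ?L p) ?L"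
      using W.vectorspace_axioms mod unfolding VectorSpace.subspace_def LinearCombinations.submodule_def by simp
  next
    show "carrier ?L = grade ?L 0 <+>\<^bsub>?L\<^esub> grade ?L 1"
    proof
      show "grade ?L 0 <+>\<^bsub>?L\<^esub> grade ?L 1 \<subseteq> carrier ?L" by (auto simp: set_add_def')
      show "carrier ?L \<subseteq> grade ?L 0 <+>\<^bsub>?L\<^esub> grade ?L 1"
      proof
        fix x assume "x \<in> carrier ?L"
        then obtain u v where "u \<in> grade L 0 \<inter> W" "v \<in> grade L (0 + 1) \<inter> W" "x = u \<oplus> v"
          using homogeneous_decompose[OF W, of x 0] by auto
        then show "x \<in> grade ?L 0 <+>\<^bsub>?L\<^esub> grade ?L 1" by (auto simp: set_add_def')
      qed
    qed
    show "grade ?L 0 \<inter> grade ?L 1 = {\<zero>\<^bsub>?L\<^esub>}" using grade_disjoint by auto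
  next
    fix x p y q assume "x \<in> grade ?L p" "y \<in> grade ?L q"
    then show "\<lbrace>x, y\<rbrace>\<^bsub>?L\<^esub> = \<ominus>\<^bsub>?L\<^esub> (koszul_sign F p q \<odot>\<^bsub>?L\<^esub> \<lbrace>y, x\<rbrace>\<^bsub>?L\<^esub>)"
      using super_skew[of x p y q] br koszul by (simp add: neg)
  next
    fix x p y q assume "x \<in> grade ?L p" "y \<in> grade ?L q"
    then show "\<lbrace>x, y\<rbrace>\<^bsub>?L\<^esub> \<in> grade ?L (p + q)" using bracket_grade[of x p y q] br by simp
  next
    fix x p y q z r assume "x \<in> grade ?L p" "y \<in> grade ?L q" "z \<in> grade ?L r"
    then show "koszul_sign F p r \<odot>\<^bsub>?L\<^esub> \<lbrace>x, \<lbrace>y, z\<rbrace>\<^bsub>?L\<^esub>\<rbrace>\<^bsub>?L\<^esub> \<oplus>\<^bsub>?L\<^esub> koszul_sign F q p \<odot>\<^bsub>?L\<^esub> \<lbrace>y, \<lbrace>z, x\<rbrace>\<^bsub>?L\<^esub>\<rbrace>\<^bsub>?L\<^esub>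
        \<oplus>\<^bsub>?L\<^esub> koszul_sign F r q \<odot>\<^bsub>?L\<^esub> \<lbrace>z, \<lbrace>x, y\<rbrace>\<^bsub>?L\<^esub>\<rbrace>\<^bsub>?L\<^esub> = \<zero>\<^bsub>?L\<^esub>"
      using super_jacobi[of x p y q z r] by simp
  qed (simp_all add: br Wc bracket_add_left bracket_add_right bracket_smult_left bracket_smult_right)
qed

lemma lie_superalgebra_derived: "lie_superalgebra F (derived F L)"
  unfolding derived_eq_restrict_super using derived_homogeneous
  by (rule lie_superalgebra_restrict_super) (simp add: bracket_in_derived)

lemma lie_superalgebra_restrict_derived_subset:
  assumes "homogeneous W" "derived_set F L \<subseteq> W"
  shows "lie_superalgebra F (restrict_super L W)"
  using assms submodule.subset[OF homogeneous_submodule]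
  by (intro lie_superalgebra_restrict_super) (blast intro: bracket_in_derived)+

end

section \<open>Isoclinism as a linear relation\<close>

context lie_superalgebra
begin

section \<open>Cosets modulo the center\<close>

lemma add_diff_cancel: "x \<in> carrier L \<Longrightarrow> y \<in> carrier L \<Longrightarrow> y \<oplus> (x \<ominus> y) = x"
  unfolding a_minus_def by (subst M.a_comm[of x]) (simp_all add: M.r_neg1 M.r_neg2)

lemma diff_zero: "x \<in> carrier L \<Longrightarrow> x \<ominus> \<zero> = x"
  using add_diff_cancel[of x \<zero>] by simp

text \<open>The degree p component of x - (u + v) is x - u. Thus a representative of the coset of a
  homogeneous element can be replaced by its component of the same degree.\<close>

lemma homogeneous_diff:
  assumes W: "homogeneous W" and x: "x \<in> grade L p"
    and u: "u \<in> grade L p" and v: "v \<in> grade L (p + 1)" and diff: "x \<ominus> (u \<oplus> v) \<in> W"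
  shows "x \<ominus> u \<in> W"
proof -
  have "x \<ominus> (u \<oplus> v) = (x \<ominus> u) \<oplus> (\<zero> \<ominus> v)"
    using x u v by (simp add: a_minus_def M.minus_add M.a_assoc)
  moreover have "x \<ominus> u \<in> grade L p" "\<zero> \<ominus> v \<in> grade L (p + 1)"
    using submodule_minus[OF grade_submodule] x u v by auto
  ultimately show ?thesis using homogeneousD[OF W] diff by metis
qed

lemma abelian_subgroup_center: "abelian_subgroup (center L) L"
proof (rule abelian_subgroupI3)
  interpret Z: submodule F "center L" L by (fact center_submodule)
  show "additive_subgroup (center L) L"
  proof (rule additive_subgroupI, rule M.add.subgroupI)
    show "\<ominus> a \<in> center L" if "a \<in> center L" for a
      using submodule_minus[OF center_submodule Z.zero_closed that] that by (simp add: a_minus_def)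
    show "center L \<noteq> {}" using Z.zero_closed by blast
  qed auto
  show "abelian_group L" by unfold_locales
qed

interpretation Z: abelian_subgroup "center L" L by (fact abelian_subgroup_center)

lemma coset_center_mem:
  assumes "l \<in> carrier L"
  shows "x \<in> center L +> l \<longleftrightarrow> x \<in> carrier L \<and> x \<ominus> l \<in> center L"
proof
  assume x: "x \<in> center L +> l"
  then have "x \<in> carrier L" using Z.a_elemrcos_carrier assms by blast
  then show "x \<in> carrier L \<and> x \<ominus> l \<in> center L"
    using Z.a_rcos_module[OF assms] x by (simp add: a_minus_def)
next
  assume "x \<in> carrier L \<and> x \<ominus> l \<in> center L"
  then show "x \<in> center L +> l"
    using Z.a_rcos_module[OF assms] by (simp add: a_minus_def)
qed

lemma coset_center_self: "l \<in> carrier L \<Longrightarrow> l \<in> center L +> l"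
  by (rule Z.a_rcos_self)

lemma coset_center_eq:
  assumes "l \<in> carrier L" "m \<in> carrier L"
  shows "center L +> l = center L +> m \<longleftrightarrow> l \<ominus> m \<in> center L"
proof
  assume "center L +> l = center L +> m"
  then show "l \<ominus> m \<in> center L" using coset_center_mem[of m l] coset_center_self[of l] assms by simp
next
  assume "l \<ominus> m \<in> center L"
  then have "l \<in> center L +> m" using coset_center_mem assms by simp
  then show "center L +> l = center L +> m" using Z.a_repr_independence' assms by metis
qed

lemma carrier_quot: "carrier (super_quot L (center L)) = (\<lambda>l. center L +> l) ` carrier L"
  by (auto simp: super_quot_def A_RCOSETS_def')

lemma grade_quot: "grade (super_quot L (center L)) p = (\<lambda>l. center L +> l) ` grade L p"
  by (simp add: super_quot_def)

lemma add_quot: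
  assumes "l \<in> carrier L" "m \<in> carrier L"
  shows "(center L +> l) \<oplus>\<^bsub>super_quot L (center L)\<^esub> (center L +> m) = center L +> (l \<oplus> m)"
  using assms by (simp add: super_quot_def Z.a_rcos_sum)

lemma smult_diff:
  assumes "c \<in> carrier F" "x \<in> carrier L" "y \<in> carrier L"
  shows "c \<odot> x \<ominus> c \<odot> y = c \<odot> (x \<ominus> y)"
  using assms by (simp add: a_minus_def smult_r_distr smult_r_minus)

text \<open>The union defining the operation runs over equal cosets, since c (a - l) is central, and
  its index set contains l.\<close>

lemma smult_quot:
  assumes c: "c \<in> carrier F" and l: "l \<in> carrier L"
  shows "c \<odot>\<^bsub>super_quot L (center L)\<^esub> (center L +> l) = center L +> c \<odot> l"
proof -
  have "center L +> c \<odot> a = center L +> c \<odot> l" if a: "a \<in> center L +> l" for a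
  proof -
    have "a \<in> carrier L" "a \<ominus> l \<in> center L" using a l by (simp_all add: coset_center_mem)
    then show ?thesis
      using c l submodule.smult_closed[OF center_submodule] by (simp add: coset_center_eq smult_diff)
  qed
  moreover have "center L +> l \<noteq> {}" using coset_center_self[OF l] by auto
  ultimately have "(\<Union>a\<in>center L +> l. center L +> c \<odot> a) = center L +> c \<odot> l"
    by (intro SUP_eq_const)
  then show ?thesis by (simp add: super_quot_def)
qed

text \<open>Expanding bilinearly, every term with a central entry vanishes: the bracket depends only
  on cosets modulo the center.\<close>

lemma bracket_central_diff:
  assumes "x \<in> carrier L" "x' \<in> carrier L" "x \<ominus> x' \<in> center L"
    and "y \<in> carrier L" "y' \<in> carrier L" "y \<ominus> y' \<in> center L"
  shows "\<lbrace>x, y\<rbrace> = \<lbrace>x', y'\<rbrace>"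
proof -
  have "x = x' \<oplus> (x \<ominus> x')" "y = y' \<oplus> (y \<ominus> y')"
    using assms by (simp_all add: add_diff_cancel)
  then have "\<lbrace>x, y\<rbrace> = \<lbrace>x' \<oplus> (x \<ominus> x'), y' \<oplus> (y \<ominus> y')\<rbrace>" by simp
  also have "\<dots> = \<lbrace>x', y'\<rbrace>"
    using assms by (simp add: bracket_add_left bracket_add_right bracket_closed)
  finally show ?thesis .
qed

lemma bracket_quot:
  assumes l: "l \<in> carrier L" and m: "m \<in> carrier L"
  shows "\<lbrace>center L +> l, center L +> m\<rbrace>\<^bsub>super_quot L (center L)\<^esub> = center L +> \<lbrace>l, m\<rbrace>"
proof -
  have "\<lbrace>a, b\<rbrace> = \<lbrace>l, m\<rbrace>" if a: "a \<in> center L +> l" and b: "b \<in> center L +> m" for a b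
    using a b l m by (intro bracket_central_diff) (simp_all add: coset_center_mem)
  moreover have "center L +> l \<noteq> {}" "center L +> m \<noteq> {}"
    using coset_center_self l m by auto
  ultimately have "(\<Union>a\<in>center L +> l. \<Union>b\<in>center L +> m. center L +> \<lbrace>a, b\<rbrace>) = center L +> \<lbrace>l, m\<rbrace>"
    by (intro SUP_eq_const) simp_all
  then show ?thesis by (simp add: super_quot_def)
qed

end

section \<open>Isomorphisms, their composites and inverses\<close>

lemma super_isoD:
  assumes "f \<in> super_iso F L K"
  shows "\<And>x. x \<in> carrier L \<Longrightarrow> f x \<in> carrier K"
    and "\<And>x y. x \<in> carrier L \<Longrightarrow> y \<in> carrier L \<Longrightarrow> f (x \<oplus>\<^bsub>L\<^esub> y) = f x \<oplus>\<^bsub>K\<^esub> f y"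
    and "\<And>c x. c \<in> carrier F \<Longrightarrow> x \<in> carrier L \<Longrightarrow> f (c \<odot>\<^bsub>L\<^esub> x) = c \<odot>\<^bsub>K\<^esub> f x"
    and "\<And>x p. x \<in> grade L p \<Longrightarrow> f x \<in> grade K p"
    and "\<And>x y. x \<in> carrier L \<Longrightarrow> y \<in> carrier L \<Longrightarrow> f \<lbrace>x, y\<rbrace>\<^bsub>L\<^esub> = \<lbrace>f x, f y\<rbrace>\<^bsub>K\<^esub>"
    and "bij_betw f (carrier L) (carrier K)"
  using assms unfolding super_iso_def LinearCombinations.module_hom_def by (auto simp: Pi_iff image_subset_iff)

lemma super_isoI:
  assumes "bij_betw f (carrier L) (carrier K)"
    and "\<And>x y. x \<in> carrier L \<Longrightarrow> y \<in> carrier L \<Longrightarrow> f (x \<oplus>\<^bsub>L\<^esub> y) = f x \<oplus>\<^bsub>K\<^esub> f y"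
    and "\<And>c x. c \<in> carrier F \<Longrightarrow> x \<in> carrier L \<Longrightarrow> f (c \<odot>\<^bsub>L\<^esub> x) = c \<odot>\<^bsub>K\<^esub> f x"
    and "\<And>x p. x \<in> grade L p \<Longrightarrow> f x \<in> grade K p"
    and "\<And>x y. x \<in> carrier L \<Longrightarrow> y \<in> carrier L \<Longrightarrow> f \<lbrace>x, y\<rbrace>\<^bsub>L\<^esub> = \<lbrace>f x, f y\<rbrace>\<^bsub>K\<^esub>"
  shows "f \<in> super_iso F L K"
  using assms unfolding super_iso_def LinearCombinations.module_hom_def by (auto simp: Pi_iff bij_betw_def)

lemma super_iso_comp:
  assumes f: "f \<in> super_iso F L K" and g: "g \<in> super_iso F K M"
  shows "g \<circ> f \<in> super_iso F L M"
  using super_isoD[OF f] super_isoD[OF g]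
  by (intro super_isoI) (auto intro: bij_betw_trans)

lemma super_iso_inv:
  assumes L: "lie_superalgebra F L" and K: "lie_superalgebra F K" and f: "f \<in> super_iso F L K"
  shows "inv_into (carrier L) f \<in> super_iso F K L"
proof -
  interpret L: lie_superalgebra F L by fact
  interpret K: lie_superalgebra F K by fact
  note f = super_isoD[OF f]
  let ?g = "inv_into (carrier L) f"
  have g: "?g y \<in> carrier L" "f (?g y) = y" if "y \<in> carrier K" for y
    using that f(6) by (auto simp: bij_betw_def inv_into_into f_inv_into_f)
  have eqI: "?g y = x" if "x \<in> carrier L" "f x = y" for x y
    using that f(6) by (auto simp: bij_betw_def)
  show ?thesis
  proof (rule super_isoI)
    show "bij_betw ?g (carrier K) (carrier L)" using f(6) by (rule bij_betw_inv_into)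
  next
    fix y p assume y: "y \<in> grade K p"
    then have yc: "y \<in> carrier K" by simp
    \<comment> \<open>By definition f maps each degree into the same degree, and the inverse must be
      shown to do so too. Comparing f u + f v with y + 0 gives f u = y, so the preimage of y is its
      component u.\<close>
    obtain u v where uv: "u \<in> grade L p" "v \<in> grade L (p + 1)" "?g y = u \<oplus>\<^bsub>L\<^esub> v"
      using L.decompose[OF g(1)[OF yc]] .
    then have "y \<oplus>\<^bsub>K\<^esub> \<zero>\<^bsub>K\<^esub> = f u \<oplus>\<^bsub>K\<^esub> f v" using g(2)[OF yc] f(2)[of u v] yc by simp
    then have "f u = y"
      using K.grade_sum_unique[of y p "\<zero>\<^bsub>K\<^esub>" "f u" "f v"] y uv f(4) by simp
    then show "?g y \<in> grade L p" using eqI[of u y] uv by simp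
  qed (auto intro!: eqI simp: f g L.bracket_closed)
qed

text \<open>The relation \<open>R\<close> collects the pairs \<open>(l, k)\<close> whose cosets modulo the centers correspond under
  the isomorphism of the central quotients. Unlike that isomorphism it can be inverted and
  composed without any computation in quotients.\<close>

locale isoclinism_relation = L: lie_superalgebra F L + K: lie_superalgebra F K
  for F :: "('f, 'm) ring_scheme" and L :: "('f, 'a) superalgebra" and K :: "('f, 'b) superalgebra" +
  fixes R :: "('a \<times> 'b) set" and b :: "'a \<Rightarrow> 'b"
  assumes rel_closed: "(l, k) \<in> R \<Longrightarrow> l \<in> carrier L \<and> k \<in> carrier K"
    and rel_add: "(l, k) \<in> R \<Longrightarrow> (m, r) \<in> R \<Longrightarrow> (l \<oplus>\<^bsub>L\<^esub> m, k \<oplus>\<^bsub>K\<^esub> r) \<in> R"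
    and rel_smult: "c \<in> carrier F \<Longrightarrow> (l, k) \<in> R \<Longrightarrow> (c \<odot>\<^bsub>L\<^esub> l, c \<odot>\<^bsub>K\<^esub> k) \<in> R"
    and rel_bracket: "(l, k) \<in> R \<Longrightarrow> (m, r) \<in> R \<Longrightarrow> (\<lbrace>l, m\<rbrace>\<^bsub>L\<^esub>, \<lbrace>k, r\<rbrace>\<^bsub>K\<^esub>) \<in> R"
    and rel_total: "l \<in> grade L p \<Longrightarrow> \<exists>k\<in>grade K p. (l, k) \<in> R"
    and rel_surj: "k \<in> grade K p \<Longrightarrow> \<exists>l\<in>grade L p. (l, k) \<in> R"
    and rel_center: "(l, k) \<in> R \<Longrightarrow> l \<in> center L \<longleftrightarrow> k \<in> center K"
    and center_rel: "l \<in> center L \<Longrightarrow> k \<in> center K \<Longrightarrow> (l, k) \<in> R"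
    and derived_iso: "b \<in> super_iso F (derived F L) (derived F K)"
    and derived_iso_bracket: "(l, k) \<in> R \<Longrightarrow> (m, r) \<in> R \<Longrightarrow> b \<lbrace>l, m\<rbrace>\<^bsub>L\<^esub> = \<lbrace>k, r\<rbrace>\<^bsub>K\<^esub>"
begin

lemma rel_minus: "(l, k) \<in> R \<Longrightarrow> (m, r) \<in> R \<Longrightarrow> (l \<ominus>\<^bsub>L\<^esub> m, k \<ominus>\<^bsub>K\<^esub> r) \<in> R"
  using rel_add[of l k "(\<ominus>\<^bsub>F\<^esub> \<one>\<^bsub>F\<^esub>) \<odot>\<^bsub>L\<^esub> m" "(\<ominus>\<^bsub>F\<^esub> \<one>\<^bsub>F\<^esub>) \<odot>\<^bsub>K\<^esub> r"] rel_smult[of "\<ominus>\<^bsub>F\<^esub> \<one>\<^bsub>F\<^esub>" m r]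
    rel_closed[of m r]
  by (simp add: L.smult_minus_1 K.smult_minus_1 a_minus_def)

lemma zero_rel: "(\<zero>\<^bsub>L\<^esub>, \<zero>\<^bsub>K\<^esub>) \<in> R"
  using center_rel submodule.zero_closed[OF L.center_submodule] submodule.zero_closed[OF K.center_submodule]
  by blast

lemma ex_related_right:
  assumes "l \<in> carrier L" obtains k where "(l, k) \<in> R"
proof -
  obtain u v where "u \<in> grade L 0" "v \<in> grade L (0 + 1)" "l = u \<oplus>\<^bsub>L\<^esub> v" using L.decompose[OF assms] .
  then show thesis using that rel_add rel_total by metis
qed

lemma ex_related_left:
  assumes "k \<in> carrier K" obtains l where "(l, k) \<in> R"
proof -
  obtain u v where "u \<in> grade K 0" "v \<in> grade K (0 + 1)" "k = u \<oplus>\<^bsub>K\<^esub> v" using K.decompose[OF assms] .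
  then show thesis using that rel_add rel_surj by metis
qed

text \<open>This recovers an honest map of cosets from \<open>R\<close>. One inclusion uses that
  differences of related pairs are central on both sides or on neither; the other adds the central
  pair (0, k' - k).\<close>

lemma Image_coset:
  assumes lk: "(l, k) \<in> R"
  shows "R `` (center L +>\<^bsub>L\<^esub> l) = center K +>\<^bsub>K\<^esub> k"
proof -
  have c: "l \<in> carrier L" "k \<in> carrier K" using rel_closed[OF lk] by auto
  show ?thesis
  proof (intro equalityI subsetI)
    fix k' assume "k' \<in> R `` (center L +>\<^bsub>L\<^esub> l)"
    then obtain l' where l': "(l', k') \<in> R" "l' \<ominus>\<^bsub>L\<^esub> l \<in> center L" using c by (auto simp: L.coset_center_mem)
    then show "k' \<in> center K +>\<^bsub>K\<^esub> k"
      using rel_center[OF rel_minus[OF l'(1) lk]] rel_closed c by (auto simp: K.coset_center_mem)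
  next
    fix k' assume "k' \<in> center K +>\<^bsub>K\<^esub> k"
    then have k': "k' \<in> carrier K" "k' \<ominus>\<^bsub>K\<^esub> k \<in> center K" using c by (simp_all add: K.coset_center_mem)
    have "(l \<oplus>\<^bsub>L\<^esub> \<zero>\<^bsub>L\<^esub>, k \<oplus>\<^bsub>K\<^esub> (k' \<ominus>\<^bsub>K\<^esub> k)) \<in> R"
      using center_rel k' submodule.zero_closed[OF L.center_submodule] by (intro rel_add lk) blast
    moreover have "k \<oplus>\<^bsub>K\<^esub> (k' \<ominus>\<^bsub>K\<^esub> k) = k'"
      using c k'(1) by (simp add: K.add_diff_cancel)
    ultimately have "(l, k') \<in> R" using c by simp
    then show "k' \<in> R `` (center L +>\<^bsub>L\<^esub> l)" using L.coset_center_self[OF c(1)] by blast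
  qed
qed

lemma isoclinic: "isoclinic F L K"
proof -
  let ?LQ = "super_quot L (center L)" and ?KQ = "super_quot K (center K)"
  \<comment> \<open>The isomorphism \<alpha> of the central quotients is the image of cosets under
    \<open>R\<close>.\<close>
  let ?a = "\<lambda>A. R `` A"
  have c: "l \<in> carrier L" "k \<in> carrier K" if "(l, k) \<in> R" for l k using rel_closed[OF that] by auto
  have iso: "?a \<in> super_iso F ?LQ ?KQ"
  proof (rule super_isoI)
    show "bij_betw ?a (carrier ?LQ) (carrier ?KQ)"
      unfolding bij_betw_def
    proof
      show "inj_on ?a (carrier ?LQ)"
      proof (rule inj_onI)
        fix A B assume "A \<in> carrier ?LQ" "B \<in> carrier ?LQ" and eq: "R `` A = R `` B"
        then obtain l m where lm: "l \<in> carrier L" "m \<in> carrier L" "A = center L +>\<^bsub>L\<^esub> l" "B = center L +>\<^bsub>L\<^esub> m"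
          by (auto simp: L.carrier_quot)
        obtain k r where kr: "(l, k) \<in> R" "(m, r) \<in> R" using ex_related_right lm by metis
        then have "k \<ominus>\<^bsub>K\<^esub> r \<in> center K" using eq lm c by (simp add: Image_coset K.coset_center_eq)
        then show "A = B" using rel_center[OF rel_minus[OF kr]] lm by (simp add: L.coset_center_eq)
      qed
      show "?a ` carrier ?LQ = carrier ?KQ"
      proof (intro equalityI subsetI)
        fix B assume "B \<in> ?a ` carrier ?LQ"
        then obtain l where "l \<in> carrier L" "B = R `` (center L +>\<^bsub>L\<^esub> l)" by (auto simp: L.carrier_quot)
        then show "B \<in> carrier ?KQ" using ex_related_right[of l] c by (metis Image_coset K.carrier_quot imageI)
      next
        fix B assume "B \<in> carrier ?KQ"
        then obtain k where "k \<in> carrier K" "B = center K +>\<^bsub>K\<^esub> k" by (auto simp: K.carrier_quot)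
        then show "B \<in> ?a ` carrier ?LQ" using ex_related_left[of k] c by (metis Image_coset L.carrier_quot imageI)
      qed
    qed
  next
    fix A B assume "A \<in> carrier ?LQ" "B \<in> carrier ?LQ"
    then obtain l m where lm: "l \<in> carrier L" "m \<in> carrier L" "A = center L +>\<^bsub>L\<^esub> l" "B = center L +>\<^bsub>L\<^esub> m"
      by (auto simp: L.carrier_quot)
    obtain k r where kr: "(l, k) \<in> R" "(m, r) \<in> R" using ex_related_right lm by metis
    show "R `` (A \<oplus>\<^bsub>?LQ\<^esub> B) = R `` A \<oplus>\<^bsub>?KQ\<^esub> R `` B"
      using lm kr c by (simp add: L.add_quot K.add_quot Image_coset rel_add)
    show "R `` \<lbrace>A, B\<rbrace>\<^bsub>?LQ\<^esub> = \<lbrace>R `` A, R `` B\<rbrace>\<^bsub>?KQ\<^esub>"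
      using lm kr c by (simp add: L.bracket_quot K.bracket_quot Image_coset rel_bracket)
  next
    fix d A assume d: "d \<in> carrier F" and "A \<in> carrier ?LQ"
    then obtain l where l: "l \<in> carrier L" "A = center L +>\<^bsub>L\<^esub> l" by (auto simp: L.carrier_quot)
    obtain k where k: "(l, k) \<in> R" using ex_related_right l by metis
    show "R `` (d \<odot>\<^bsub>?LQ\<^esub> A) = d \<odot>\<^bsub>?KQ\<^esub> R `` A"
      using l k d c by (simp add: L.smult_quot K.smult_quot Image_coset rel_smult)
  next
    fix A p assume "A \<in> grade ?LQ p"
    then obtain l where l: "l \<in> grade L p" "A = center L +>\<^bsub>L\<^esub> l" by (auto simp: L.grade_quot)
    obtain k where "k \<in> grade K p" "(l, k) \<in> R" using rel_total l by metis
    then show "R `` A \<in> grade ?KQ p" using l by (auto simp: K.grade_quot Image_coset)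
  qed
  \<comment> \<open>Representatives of corresponding cosets are related: k differs from a partner k'
    of l by a central element, and \<open>R\<close> contains the pair of zero and that
    element.\<close>
  have rel: "(l, k) \<in> R"
    if eq: "center K +>\<^bsub>K\<^esub> k = R `` (center L +>\<^bsub>L\<^esub> l)" and lk: "l \<in> carrier L" "k \<in> carrier K" for l k
  proof -
    obtain k' where k': "(l, k') \<in> R" using ex_related_right lk by metis
    then have "k \<ominus>\<^bsub>K\<^esub> k' \<in> center K" using eq lk c by (simp add: Image_coset K.coset_center_eq)
    then have "(l \<oplus>\<^bsub>L\<^esub> \<zero>\<^bsub>L\<^esub>, k' \<oplus>\<^bsub>K\<^esub> (k \<ominus>\<^bsub>K\<^esub> k')) \<in> R"
      using center_rel submodule.zero_closed[OF L.center_submodule] by (intro rel_add k') blast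
    moreover have "k' \<oplus>\<^bsub>K\<^esub> (k \<ominus>\<^bsub>K\<^esub> k') = k"
      using lk c[OF k'] by (simp add: K.add_diff_cancel)
    ultimately show ?thesis using lk by simp
  qed
  show ?thesis
    unfolding isoclinic_def
    by (intro bexI[OF _ iso] bexI[OF _ derived_iso] ballI impI derived_iso_bracket rel)
qed

text \<open>Symmetry of isoclinism: the conditions on \<open>R\<close> are symmetric in the two
  algebras, and \<open>b\<close> is replaced by its inverse.\<close>

lemma converse: "isoclinism_relation F K L (R\<inverse>) (inv_into (derived_set F L) b)"
proof -
  let ?g = "inv_into (derived_set F L) b"
  have g: "?g \<in> super_iso F (derived F K) (derived F L)"
    using super_iso_inv[OF L.lie_superalgebra_derived K.lie_superalgebra_derived derived_iso]
    by (simp add: derived_def)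
  have "inj_on b (derived_set F L)"
    using super_isoD(6)[OF derived_iso] by (simp add: bij_betw_def derived_def)
  then have "?g (b x) = x" if "x \<in> derived_set F L" for x using that by simp
  then have "?g \<lbrace>k, r\<rbrace>\<^bsub>K\<^esub> = \<lbrace>l, m\<rbrace>\<^bsub>L\<^esub>" if "(l, k) \<in> R" "(m, r) \<in> R" for l k m r
    using derived_iso_bracket[OF that] L.bracket_in_derived[of l m] rel_closed that by metis
  then show ?thesis
    using g rel_add rel_smult rel_bracket rel_closed rel_total rel_surj rel_center center_rel
    by unfold_locales auto
qed

end

text \<open>Transitivity of isoclinism. Central elements of the outer algebras are linked through
  the zero of \<open>K\<close>.\<close>

lemma isoclinism_relation_comp:
  assumes "isoclinism_relation F L K R b" "isoclinism_relation F K M S c"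
  shows "isoclinism_relation F L M (R O S) (c \<circ> b)"
proof -
  interpret R: isoclinism_relation F L K R b by fact
  interpret S: isoclinism_relation F K M S c by fact
  show ?thesis
  proof
    show "c \<circ> b \<in> super_iso F (derived F L) (derived F M)"
      using R.derived_iso S.derived_iso by (rule super_iso_comp)
  next
    fix l k assume lk: "l \<in> center L" "k \<in> center M"
    have "\<zero>\<^bsub>K\<^esub> \<in> center K" using submodule.zero_closed[OF R.K.center_submodule] .
    then show "(l, k) \<in> R O S" using R.center_rel S.center_rel lk by blast
  next
    fix l k assume "(l, k) \<in> R O S"
    then show "l \<in> carrier L \<and> k \<in> carrier M" "l \<in> center L \<longleftrightarrow> k \<in> center M"
      using R.rel_closed S.rel_closed R.rel_center S.rel_center by blast+
  next
    fix l k m r assume "(l, k) \<in> R O S" "(m, r) \<in> R O S"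
    then obtain x y where *: "(l, x) \<in> R" "(x, k) \<in> S" "(m, y) \<in> R" "(y, r) \<in> S" by blast
    show "(l \<oplus>\<^bsub>L\<^esub> m, k \<oplus>\<^bsub>M\<^esub> r) \<in> R O S" using * R.rel_add S.rel_add by blast
    show "(\<lbrace>l, m\<rbrace>\<^bsub>L\<^esub>, \<lbrace>k, r\<rbrace>\<^bsub>M\<^esub>) \<in> R O S" using * R.rel_bracket S.rel_bracket by blast
    show "(c \<circ> b) \<lbrace>l, m\<rbrace>\<^bsub>L\<^esub> = \<lbrace>k, r\<rbrace>\<^bsub>M\<^esub>" using * R.derived_iso_bracket S.derived_iso_bracket by simp
  next
    fix d l k assume "d \<in> carrier F" "(l, k) \<in> R O S"
    then show "(d \<odot>\<^bsub>L\<^esub> l, d \<odot>\<^bsub>M\<^esub> k) \<in> R O S" using R.rel_smult S.rel_smult by blast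
  next
    fix l p assume "l \<in> grade L p"
    then show "\<exists>k\<in>grade M p. (l, k) \<in> R O S" using R.rel_total S.rel_total by blast
  next
    fix k p assume "k \<in> grade M p"
    then show "\<exists>l\<in>grade L p. (l, k) \<in> R O S" using R.rel_surj S.rel_surj by blast
  qed
qed

text \<open>Together with \<open>isoclinism_relation.isoclinic\<close>, this makes the relational
  form equivalent to isoclinism. The delicate condition is \<open>rel_surj\<close>, which asks for
  homogeneous preimages.\<close>

lemma isoclinism_relation_of_isoclinic:
  assumes L: "lie_superalgebra F L" and K: "lie_superalgebra F K" and iso: "isoclinic F L K"
  obtains R b where "isoclinism_relation F L K R b"
proof -
  interpret L: lie_superalgebra F L by fact
  interpret K: lie_superalgebra F K by fact
  let ?LQ = "super_quot L (center L)" and ?KQ = "super_quot K (center K)"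
  let ?c = "\<lambda>l. center L +>\<^bsub>L\<^esub> l" and ?d = "\<lambda>k. center K +>\<^bsub>K\<^esub> k"
  obtain a b where a: "a \<in> super_iso F ?LQ ?KQ" and b: "b \<in> super_iso F (derived F L) (derived F K)"
    and comp: "\<And>l m k r. l \<in> carrier L \<Longrightarrow> m \<in> carrier L \<Longrightarrow> k \<in> carrier K \<Longrightarrow> r \<in> carrier K \<Longrightarrow>
      ?d k = a (?c l) \<Longrightarrow> ?d r = a (?c m) \<Longrightarrow> b \<lbrace>l, m\<rbrace>\<^bsub>L\<^esub> = \<lbrace>k, r\<rbrace>\<^bsub>K\<^esub>"
    using iso unfolding isoclinic_def by blast
  note a = super_isoD[OF a]
  define R where "R = {(l, k). l \<in> carrier L \<and> k \<in> carrier K \<and> ?d k = a (?c l)}"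
  have R: "(l, k) \<in> R \<longleftrightarrow> l \<in> carrier L \<and> k \<in> carrier K \<and> ?d k = a (?c l)" for l k
    by (simp add: R_def)
  have cc: "?c l \<in> carrier ?LQ" if "l \<in> carrier L" for l using that by (simp add: L.carrier_quot)
  have inj: "inj_on a (carrier ?LQ)" and surj: "a ` carrier ?LQ = carrier ?KQ"
    using a(6) by (auto simp: bij_betw_def)
  have Lz: "?c l = ?c \<zero>\<^bsub>L\<^esub> \<longleftrightarrow> l \<in> center L" if "l \<in> carrier L" for l
    using that by (simp add: L.coset_center_eq L.diff_zero)
  have Kz: "?d k = ?d \<zero>\<^bsub>K\<^esub> \<longleftrightarrow> k \<in> center K" if "k \<in> carrier K" for k
    using that by (simp add: K.coset_center_eq K.diff_zero)
  \<comment> \<open>Zero is preserved because scaling any coset by the zero scalar gives the coset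
    of zero; this avoids setting up the quotients as vector spaces.\<close>
  have a0: "a (?c \<zero>\<^bsub>L\<^esub>) = ?d \<zero>\<^bsub>K\<^esub>"
  proof -
    have "a (?c \<zero>\<^bsub>L\<^esub>) \<in> carrier ?KQ" using a(1) cc by simp
    then obtain k where k: "k \<in> carrier K" "a (?c \<zero>\<^bsub>L\<^esub>) = ?d k" by (auto simp: K.carrier_quot)
    have "a (\<zero>\<^bsub>F\<^esub> \<odot>\<^bsub>?LQ\<^esub> ?c \<zero>\<^bsub>L\<^esub>) = \<zero>\<^bsub>F\<^esub> \<odot>\<^bsub>?KQ\<^esub> a (?c \<zero>\<^bsub>L\<^esub>)" using a(3) cc by simp
    then show ?thesis using k by (simp add: L.smult_quot K.smult_quot)
  qed
  have add: "(l \<oplus>\<^bsub>L\<^esub> m, k \<oplus>\<^bsub>K\<^esub> r) \<in> R" if "(l, k) \<in> R" "(m, r) \<in> R" for l k m r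
    using that a(2)[of "?c l" "?c m"] cc by (simp add: R L.add_quot K.add_quot[symmetric])
  have tot: "\<exists>k\<in>grade K p. (l, k) \<in> R" if l: "l \<in> grade L p" for l p
  proof -
    have "a (?c l) \<in> grade ?KQ p" using a(4)[of "?c l" p] l by (simp add: L.grade_quot)
    then obtain k where "k \<in> grade K p" "a (?c l) = ?d k" by (auto simp: K.grade_quot)
    then show ?thesis using l by (auto simp: R)
  qed
  have "isoclinism_relation F L K R b"
  proof
    show "b \<in> super_iso F (derived F L) (derived F K)" by (fact b)
  next
    fix l k assume "(l, k) \<in> R"
    then show "l \<in> carrier L \<and> k \<in> carrier K" by (simp add: R)
    show "l \<in> center L \<longleftrightarrow> k \<in> center K"
      using \<open>(l, k) \<in> R\<close> Lz[of l] Kz[of k] a0 inj_onD[OF inj, of "?c l" "?c \<zero>\<^bsub>L\<^esub>"] cc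
      by (auto simp: R)
  next
    fix l k m r assume lk: "(l, k) \<in> R" "(m, r) \<in> R"
    then show "(l \<oplus>\<^bsub>L\<^esub> m, k \<oplus>\<^bsub>K\<^esub> r) \<in> R" by (rule add)
    show "(\<lbrace>l, m\<rbrace>\<^bsub>L\<^esub>, \<lbrace>k, r\<rbrace>\<^bsub>K\<^esub>) \<in> R"
      using lk a(5)[of "?c l" "?c m"] cc
      by (simp add: R L.bracket_quot K.bracket_quot[symmetric] L.bracket_closed K.bracket_closed)
    show "b \<lbrace>l, m\<rbrace>\<^bsub>L\<^esub> = \<lbrace>k, r\<rbrace>\<^bsub>K\<^esub>" using lk comp by (simp add: R)
  next
    fix e l k assume "e \<in> carrier F" "(l, k) \<in> R"
    then show "(e \<odot>\<^bsub>L\<^esub> l, e \<odot>\<^bsub>K\<^esub> k) \<in> R"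
      using a(3)[of e "?c l"] cc by (simp add: R L.smult_quot K.smult_quot[symmetric])
  next
    fix l k assume "l \<in> center L" "k \<in> center K"
    then show "(l, k) \<in> R" using Lz[of l] Kz[of k] a0 by (simp add: R)
  next
    fix l p assume "l \<in> grade L p"
    then show "\<exists>k\<in>grade K p. (l, k) \<in> R" by (rule tot)
  next
    fix k p assume k: "k \<in> grade K p"
    then have "?d k \<in> a ` carrier ?LQ" unfolding surj by (simp add: K.carrier_quot)
    then obtain l where l: "l \<in> carrier L" "?d k = a (?c l)" by (auto simp: L.carrier_quot)
    \<comment> \<open>The preimage l need not be homogeneous. Its degree p component u has a partner
      x of degree p, and comparing degrees in the central element k - (x + y) shows that k - x is
      central, so u is related to k.\<close>
    obtain u v where uv: "u \<in> grade L p" "v \<in> grade L (p + 1)" "l = u \<oplus>\<^bsub>L\<^esub> v" using L.decompose[OF l(1)] .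
    obtain x y where xy: "x \<in> grade K p" "(u, x) \<in> R" "y \<in> grade K (p + 1)" "(v, y) \<in> R"
      using tot uv by metis
    have "?d k = ?d (x \<oplus>\<^bsub>K\<^esub> y)" using add[OF xy(2,4)] l uv by (simp add: R)
    then have "k \<ominus>\<^bsub>K\<^esub> (x \<oplus>\<^bsub>K\<^esub> y) \<in> center K" using k xy by (simp add: K.coset_center_eq)
    then have "k \<ominus>\<^bsub>K\<^esub> x \<in> center K" using K.homogeneous_diff[OF K.center_homogeneous k] xy by simp
    then have "?d k = ?d x" using k xy by (simp add: K.coset_center_eq)
    then have "(u, k) \<in> R" using xy k uv by (simp add: R)
    then show "\<exists>l\<in>grade L p. (l, k) \<in> R" using uv by blast
  qed
  then show thesis by (rule that)
qed

section \<open>Stem subalgebras\<close>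

context lie_superalgebra
begin

text \<open>Working in each degree separately keeps the sum graded. The components of a central
  element are central, so the condition on W \<inter> Z(L) can be checked degree by degree.\<close>

lemma ex_stem_subspace:
  obtains W where "homogeneous W" "derived_set F L \<subseteq> W" "W \<inter> center L \<subseteq> derived_set F L"
    "\<And>x. x \<in> carrier L \<Longrightarrow> \<exists>w\<in>W. \<exists>z\<in>center L. x = w \<oplus> z"
proof -
  let ?D = "derived_set F L" and ?Z = "center L"
  have "\<exists>W. submodule F W L \<and> ?D \<inter> grade L p \<subseteq> W \<and> W \<subseteq> grade L p
      \<and> W \<inter> (?Z \<inter> grade L p) \<subseteq> ?D \<inter> grade L p
      \<and> (\<forall>x\<in>grade L p. \<exists>w\<in>W. \<exists>z\<in>?Z \<inter> grade L p. x = w \<oplus> z)" for p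
    by (rule maximal_submodule_complement[OF grade_submodule
          submodule_Int[OF derived_submodule grade_submodule] Int_lower2
          submodule_Int[OF center_submodule grade_submodule] Int_lower2]) blast
  then obtain W where W: "\<And>p. submodule F (W p) L" "\<And>p. ?D \<inter> grade L p \<subseteq> W p" "\<And>p. W p \<subseteq> grade L p"
    "\<And>p. W p \<inter> (?Z \<inter> grade L p) \<subseteq> ?D \<inter> grade L p"
    "\<And>p x. x \<in> grade L p \<Longrightarrow> \<exists>w\<in>W p. \<exists>z\<in>?Z \<inter> grade L p. x = w \<oplus> z"
    by metis
  define S where "S = {u \<oplus> v | u v. u \<in> W 0 \<and> v \<in> W 1}"
  have S: "homogeneous S" "\<And>p. grade L p \<inter> S = W p"
    using homogeneous_sum[of W] W(1,3) unfolding S_def by auto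
  note D = derived_homogeneous and sub = homogeneous_submodule[OF S(1)]
  show thesis
  proof (rule that)
    show "homogeneous S" by (fact S)
    show "?D \<subseteq> S"
    proof
      fix x assume "x \<in> ?D"
      then obtain u v where "u \<in> grade L 0 \<inter> ?D" "v \<in> grade L (0 + 1) \<inter> ?D" "x = u \<oplus> v"
        using homogeneous_decompose[OF D, of x 0] by blast
      then show "x \<in> S" using W(2)[of 0] W(2)[of 1] by (auto simp: S_def)
    qed
    show "S \<inter> ?Z \<subseteq> ?D"
    proof
      fix x assume x: "x \<in> S \<inter> ?Z"
      then obtain u v where uv: "u \<in> W 0" "v \<in> W 1" "x = u \<oplus> v" by (auto simp: S_def)
      then have g: "u \<in> grade L 0" "v \<in> grade L 1" using W(3) by auto
      then have "u \<in> ?Z" "v \<in> ?Z" using homogeneousD[OF center_homogeneous, of u 0 v] uv x by auto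
      then have "u \<in> ?D" "v \<in> ?D" using W(4) uv g by blast+
      then show "x \<in> ?D" using uv submodule.m_closed[OF derived_submodule] by simp
    qed
    fix x assume "x \<in> carrier L"
    then obtain u v where uv: "u \<in> grade L 0" "v \<in> grade L (0 + 1)" "x = u \<oplus> v" using decompose by blast
    obtain w z where wz: "w \<in> W 0" "z \<in> ?Z" "u = w \<oplus> z" using W(5)[OF uv(1)] by blast
    obtain w' z' where wz': "w' \<in> W 1" "z' \<in> ?Z" "v = w' \<oplus> z'" using W(5)[OF uv(2)] by auto
    have c: "w \<in> carrier L" "w' \<in> carrier L" using wz wz' submodule.subset[OF W(1)] by auto
    have "x = (w \<oplus> w') \<oplus> (z \<oplus> z')" using uv wz wz' c by (simp add: M.a_ac)
    moreover have "w \<oplus> w' \<in> S" using wz wz' by (auto simp: S_def)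
    moreover have "z \<oplus> z' \<in> ?Z" using wz wz' submodule.m_closed[OF center_submodule] by simp
    ultimately show "\<exists>w\<in>S. \<exists>z\<in>?Z. x = w \<oplus> z" by blast
  qed
qed

end

text \<open>These conditions make \<open>W\<close> a subalgebra isoclinic to \<open>L\<close>;
  stemness will follow from the further inclusion of W \<inter> Z(L) in the derived set.\<close>

locale central_supplement = lie_superalgebra +
  fixes W
  assumes homogeneous_W: "homogeneous W"
    and derived_subset: "derived_set F L \<subseteq> W"
    and supplement: "x \<in> carrier L \<Longrightarrow> \<exists>w\<in>W. \<exists>z\<in>center L. x = w \<oplus> z"
begin

abbreviation "T \<equiv> restrict_super L W"

text \<open>The inclusion of \<open>W\<close> induces an isomorphism from W / (W \<inter> Z(L)) onto
  L / Z(L); this is its inverse, written as a relation.\<close>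

abbreviation "central_diff \<equiv> {(l, w). l \<in> carrier L \<and> w \<in> W \<and> l \<ominus> w \<in> center L}"

lemma W_submodule: "submodule F W L"
  using homogeneous_W by (rule homogeneous_submodule)

lemma W_closed [simp]: "w \<in> W \<Longrightarrow> w \<in> carrier L"
  using submodule.subset[OF W_submodule] by blast

lemma ex_central_diff:
  assumes "x \<in> carrier L"
  obtains w where "w \<in> W" "x \<ominus> w \<in> center L"
proof -
  obtain w z where wz: "w \<in> W" "z \<in> center L" "x = w \<oplus> z" using supplement[OF assms] by blast
  have "x \<ominus> w = z" using wz by (simp add: a_minus_def M.a_comm[of w] M.a_assoc M.r_neg)
  then show thesis using that wz by simp
qed

sublocale T: lie_superalgebra F T
  using homogeneous_W derived_subset by (rule lie_superalgebra_restrict_derived_subset)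

text \<open>What annihilates \<open>W\<close> annihilates W + Z(L), which is all of
  \<open>L\<close>.\<close>

lemma center_T: "center T = center L \<inter> W"
proof
  show "center L \<inter> W \<subseteq> center T" unfolding center_def using W_closed by auto
  show "center T \<subseteq> center L \<inter> W"
  proof
    fix z assume "z \<in> center T"
    then have z: "z \<in> W" "\<And>w. w \<in> W \<Longrightarrow> \<lbrace>z, w\<rbrace> = \<zero>" unfolding center_def by auto
    have "\<lbrace>z, x\<rbrace> = \<zero>" if x: "x \<in> carrier L" for x
    proof -
      obtain w u where "w \<in> W" "u \<in> center L" "x = w \<oplus> u" using supplement[OF x] by blast
      then show ?thesis using z by (simp add: bracket_add_right)
    qed
    then show "z \<in> center L \<inter> W" using z(1) W_closed by (intro IntI centerI)
  qed
qed

lemma submodule_T: "X \<subseteq> W \<Longrightarrow> submodule F X T \<longleftrightarrow> submodule F X L"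
  using module_axioms T.module_axioms by (auto simp: LinearCombinations.submodule_def)

text \<open>Central corrections move both entries of a bracket into \<open>W\<close> without
  changing its value.\<close>

lemma derived_set_T: "derived_set F T = derived_set F L"
proof
  show "derived_set F T \<subseteq> derived_set F L"
    using derived_submodule derived_subset
    by (intro T.derived_set_subset) (simp_all add: submodule_T bracket_in_derived)
  have DW: "derived_set F T \<subseteq> W" using T.derived_closed by auto
  show "derived_set F L \<subseteq> derived_set F T"
  proof (rule derived_set_subset)
    show "submodule F (derived_set F T) L" using T.derived_submodule submodule_T[OF DW] by simp
    fix x y assume xy: "x \<in> carrier L" "y \<in> carrier L"
    obtain u v where uv: "u \<in> W" "x \<ominus> u \<in> center L" "v \<in> W" "y \<ominus> v \<in> center L"
      using ex_central_diff xy by metis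
    then have "\<lbrace>x, y\<rbrace> = \<lbrace>u, v\<rbrace>" using xy by (intro bracket_central_diff) simp_all
    then show "\<lbrace>x, y\<rbrace> \<in> derived_set F T" using T.bracket_in_derived[of u v] uv by simp
  qed
qed

lemma isoclinism_relation_T:
  "isoclinism_relation F L T central_diff id"
proof
  show "id \<in> super_iso F (derived F L) (derived F T)"
    using derived_subset by (intro super_isoI) (auto simp: derived_eq_restrict_super derived_set_T)
next
  fix l k m r
  assume "(l, k) \<in> central_diff"
    "(m, r) \<in> central_diff"
  then have *: "l \<in> carrier L" "k \<in> W" "l \<ominus> k \<in> center L" "m \<in> carrier L" "r \<in> W" "m \<ominus> r \<in> center L"
    by auto
  have "(l \<oplus> m) \<ominus> (k \<oplus> r) = (l \<ominus> k) \<oplus> (m \<ominus> r)"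
    using * by (simp add: a_minus_def M.minus_add M.a_ac)
  then show "(l \<oplus> m, k \<oplus>\<^bsub>T\<^esub> r) \<in> central_diff"
    using * submodule.m_closed[OF center_submodule] submodule.m_closed[OF W_submodule] by simp
  have br: "\<lbrace>l, m\<rbrace> = \<lbrace>k, r\<rbrace>" using * by (intro bracket_central_diff) simp_all
  then show "id \<lbrace>l, m\<rbrace> = \<lbrace>k, r\<rbrace>\<^bsub>T\<^esub>" by simp
  have "\<lbrace>k, r\<rbrace> \<in> W" using * derived_subset bracket_in_derived by auto
  then show "(\<lbrace>l, m\<rbrace>, \<lbrace>k, r\<rbrace>\<^bsub>T\<^esub>) \<in> central_diff"
    using br submodule.zero_closed[OF center_submodule] by (simp add: a_minus_def M.r_neg)
next
  fix c l k assume c: "c \<in> carrier F"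
    and "(l, k) \<in> central_diff"
  then show "(c \<odot> l, c \<odot>\<^bsub>T\<^esub> k) \<in> central_diff"
    using submodule.smult_closed[OF center_submodule] submodule.smult_closed[OF W_submodule]
    by (simp add: smult_diff)
next
  fix l p assume l: "l \<in> grade L p"
  obtain w where w: "w \<in> W" "l \<ominus> w \<in> center L" using ex_central_diff[OF grade_closed[OF l]] .
  \<comment> \<open>The element w close to l may be inhomogeneous; its degree p component is a
    partner of l, since the center is graded.\<close>
  obtain u v where uv: "u \<in> grade L p \<inter> W" "v \<in> grade L (p + 1) \<inter> W" "w = u \<oplus> v"
    using homogeneous_decompose[OF homogeneous_W w(1)] .
  then have "l \<ominus> u \<in> center L" using homogeneous_diff[OF center_homogeneous l] w by blast
  then show "\<exists>k\<in>grade T p. (l, k) \<in> central_diff"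
    using uv l by auto
next
  fix k p assume "k \<in> grade T p"
  then show "\<exists>l\<in>grade L p. (l, k) \<in> central_diff"
    using submodule.zero_closed[OF center_submodule] by (intro bexI[of _ k]) (auto simp: a_minus_def M.r_neg)
next
  fix l k assume "(l, k) \<in> central_diff"
  then have *: "l \<in> carrier L" "k \<in> W" "l \<ominus> k \<in> center L" by auto
  show "l \<in> carrier L \<and> k \<in> carrier T" using * by simp
  have "l = k \<oplus> (l \<ominus> k)" using * by (simp add: add_diff_cancel)
  moreover have "k = l \<ominus> (l \<ominus> k)" using * by (simp add: a_minus_def M.minus_add M.r_neg1 M.r_neg2)
  ultimately have "l \<in> center L \<longleftrightarrow> k \<in> center L"
    using * submodule.m_closed[OF center_submodule] submodule_minus[OF center_submodule] by metis
  then show "l \<in> center L \<longleftrightarrow> k \<in> center T" using * by (simp add: center_T)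
next
  fix l k assume "l \<in> center L" "k \<in> center T"
  then show "(l, k) \<in> central_diff"
    using submodule_minus[OF center_submodule] by (simp add: center_T)
qed

end

section \<open>Dimensions\<close>

context isoclinism_relation
begin

lemma derived_iso_zero: "b \<zero>\<^bsub>L\<^esub> = \<zero>\<^bsub>K\<^esub>"
proof -
  note b = super_isoD[OF derived_iso, unfolded derived_eq_restrict_super, simplified]
  have z: "\<zero>\<^bsub>L\<^esub> \<in> derived_set F L" using submodule.zero_closed[OF L.derived_submodule] .
  show ?thesis using b(3)[OF L.R.zero_closed z] b(1)[OF z] by simp
qed

text \<open>On the derived set \<open>b\<close> agrees with the correspondence of cosets: the
  elements where it does form a subspace containing all brackets. With \<open>rel_center\<close>,
  \<open>b\<close> therefore preserves centrality there.\<close>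

lemma derived_rel: "x \<in> derived_set F L \<Longrightarrow> (x, b x) \<in> R"
proof -
  note b = super_isoD[OF derived_iso, unfolded derived_eq_restrict_super, simplified]
  let ?S = "{x \<in> derived_set F L. (x, b x) \<in> R}"
  have "derived_set F L \<subseteq> ?S"
  proof (rule L.derived_set_subset)
    show "submodule F ?S L"
    proof (rule LinearCombinations.submodule.intro)
      show "Module.module F L" by unfold_locales
      show "?S \<subseteq> carrier L" by auto
      show "\<zero>\<^bsub>L\<^esub> \<in> ?S" using submodule.zero_closed[OF L.derived_submodule] derived_iso_zero zero_rel by simp
      show "v \<oplus>\<^bsub>L\<^esub> w \<in> ?S" if "v \<in> ?S" "w \<in> ?S" for v w
        using that submodule.m_closed[OF L.derived_submodule] rel_add by (simp add: b)
      show "c \<odot>\<^bsub>L\<^esub> v \<in> ?S" if "c \<in> carrier F" "v \<in> ?S" for c v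
        using that submodule.smult_closed[OF L.derived_submodule] rel_smult by (simp add: b)
    qed
    fix x y assume xy: "x \<in> carrier L" "y \<in> carrier L"
    obtain k r where "(x, k) \<in> R" "(y, r) \<in> R" using ex_related_right xy by metis
    then show "\<lbrace>x, y\<rbrace>\<^bsub>L\<^esub> \<in> ?S"
      using rel_bracket derived_iso_bracket L.bracket_in_derived xy by simp
  qed
  then show "x \<in> derived_set F L \<Longrightarrow> (x, b x) \<in> R" by auto
qed

text \<open>On \<open>L\<close> the relation is corrected by \<open>b\<close> on the center, which a stem algebra has inside its
  derived algebra; on chosen complements of the centers \<open>R\<close> is already injective.\<close>

lemma stem_edim_grade_le:
  assumes stem: "stem F L"
  shows "edim F (L\<lparr>carrier := grade L p\<rparr>) \<le> edim F (K\<lparr>carrier := grade K p\<rparr>)"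
proof -
  let ?LZ = "center L \<inter> grade L p" and ?KZ = "center K \<inter> grade K p"
  note b = super_isoD[OF derived_iso, unfolded derived_eq_restrict_super, simplified]
  note LZ = L.submodule_Int[OF L.center_submodule L.grade_submodule[of p]]
  note KZ = K.submodule_Int[OF K.center_submodule K.grade_submodule[of p]]
  have zero: "{\<zero>\<^bsub>L\<^esub>} \<subseteq> grade L p" "{\<zero>\<^bsub>K\<^esub>} \<subseteq> grade K p" by simp_all
  \<comment> \<open>\<open>C\<close> and \<open>C'\<close> complement the centers within degree p;
    this is the case D = {0} of the Zorn argument.\<close>
  obtain C where C: "submodule F C L" "C \<subseteq> grade L p" "C \<inter> ?LZ \<subseteq> {\<zero>\<^bsub>L\<^esub>}"
    "\<And>x. x \<in> grade L p \<Longrightarrow> \<exists>w\<in>C. \<exists>z\<in>?LZ. x = w \<oplus>\<^bsub>L\<^esub> z"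
    by (rule L.maximal_submodule_complement[OF L.grade_submodule[of p] L.submodule_zero zero(1) LZ Int_lower2])
      (rule that; blast)
  obtain C' where C': "submodule F C' K" "C' \<subseteq> grade K p" "C' \<inter> ?KZ \<subseteq> {\<zero>\<^bsub>K\<^esub>}"
    "\<And>x. x \<in> grade K p \<Longrightarrow> \<exists>w\<in>C'. \<exists>z\<in>?KZ. x = w \<oplus>\<^bsub>K\<^esub> z"
    by (rule K.maximal_submodule_complement[OF K.grade_submodule[of p] K.submodule_zero zero(2) KZ Int_lower2])
      (rule that; blast)
  interpret C: submodule F C L by (fact C)
  interpret C': submodule F C' K by (fact C')
  have D: "z \<in> derived_set F L" if "z \<in> center L" for z using stem that by (auto simp: stem_def)
  \<comment> \<open>Stemness places z in the derived set, so b z is meaningful there, and it is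
    central by \<open>derived_rel\<close>.\<close>
  have bz: "b z \<in> ?KZ" if "z \<in> ?LZ" for z
    using that b(4)[of z p] D rel_center[OF derived_rel, of z] by auto
  have cL: "z \<in> carrier L" "v \<in> carrier L" "v \<in> grade L p" if "z \<in> ?LZ" "v \<in> C" for z v
    using that C(2) L.grade_closed by auto
  have cK: "z \<in> carrier K" "v \<in> carrier K" "v \<in> grade K p" if "z \<in> ?KZ" "v \<in> C'" for z v
    using that C'(2) K.grade_closed by auto
  \<comment> \<open>\<open>P\<close> is the graph of z + v \<mapsto> b z + w, where w is the element
    of \<open>C'\<close> related to v.\<close>
  define P where "P = {(z \<oplus>\<^bsub>L\<^esub> v, b z \<oplus>\<^bsub>K\<^esub> w) | z v w. z \<in> ?LZ \<and> v \<in> C \<and> w \<in> C' \<and> (v, w) \<in> R}"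
  have PI: "(z \<oplus>\<^bsub>L\<^esub> v, b z \<oplus>\<^bsub>K\<^esub> w) \<in> P" if "z \<in> ?LZ" "v \<in> C" "w \<in> C'" "(v, w) \<in> R" for z v w
    using that unfolding P_def by blast
  show ?thesis
  proof (rule edim_le_of_linear_relation)
    show "vectorspace F (L\<lparr>carrier := grade L p\<rparr>)" using L.grade_submodule by (rule L.submodule_vs)
    show "vectorspace F (K\<lparr>carrier := grade K p\<rparr>)" using K.grade_submodule by (rule K.submodule_vs)
    show "P \<subseteq> carrier (L\<lparr>carrier := grade L p\<rparr>) \<times> carrier (K\<lparr>carrier := grade K p\<rparr>)"
    proof
      fix q assume "q \<in> P"
      then obtain z v w where q: "q = (z \<oplus>\<^bsub>L\<^esub> v, b z \<oplus>\<^bsub>K\<^esub> w)" "z \<in> ?LZ" "v \<in> C" "w \<in> C'"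
        unfolding P_def by blast
      then have "z \<oplus>\<^bsub>L\<^esub> v \<in> grade L p" "b z \<oplus>\<^bsub>K\<^esub> w \<in> grade K p"
        using bz[OF q(2)] C(2) C'(2)
        by (auto intro: submodule.m_closed[OF L.grade_submodule] submodule.m_closed[OF K.grade_submodule])
      then show "q \<in> carrier (L\<lparr>carrier := grade L p\<rparr>) \<times> carrier (K\<lparr>carrier := grade K p\<rparr>)"
        using q by simp
    qed
  next
    fix x y x' y' assume "(x, y) \<in> P" "(x', y') \<in> P"
    then obtain z v w z' v' w' where *: "x = z \<oplus>\<^bsub>L\<^esub> v" "y = b z \<oplus>\<^bsub>K\<^esub> w" "x' = z' \<oplus>\<^bsub>L\<^esub> v'" "y' = b z' \<oplus>\<^bsub>K\<^esub> w'"
      "z \<in> ?LZ" "v \<in> C" "w \<in> C'" "(v, w) \<in> R" "z' \<in> ?LZ" "v' \<in> C" "w' \<in> C'" "(v', w') \<in> R"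
      unfolding P_def by blast
    note c = cL[OF *(5,6)] cL[OF *(9,10)] cK[OF bz[OF *(5)] *(7)] cK[OF bz[OF *(9)] *(11)]
    have "x \<oplus>\<^bsub>L\<^esub> x' = (z \<oplus>\<^bsub>L\<^esub> z') \<oplus>\<^bsub>L\<^esub> (v \<oplus>\<^bsub>L\<^esub> v')" using * c by (simp add: L.M.a_ac)
    moreover have "y \<oplus>\<^bsub>K\<^esub> y' = b (z \<oplus>\<^bsub>L\<^esub> z') \<oplus>\<^bsub>K\<^esub> (w \<oplus>\<^bsub>K\<^esub> w')"
      using * c D by (simp add: b K.M.a_ac)
    moreover have "z \<oplus>\<^bsub>L\<^esub> z' \<in> ?LZ" using submodule.m_closed[OF LZ] * by blast
    moreover have "(v \<oplus>\<^bsub>L\<^esub> v', w \<oplus>\<^bsub>K\<^esub> w') \<in> R" using * rel_add by blast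
    ultimately have "(x \<oplus>\<^bsub>L\<^esub> x', y \<oplus>\<^bsub>K\<^esub> y') \<in> P" using PI * by simp
    then show "(x \<oplus>\<^bsub>L\<lparr>carrier := grade L p\<rparr>\<^esub> x', y \<oplus>\<^bsub>K\<lparr>carrier := grade K p\<rparr>\<^esub> y') \<in> P" by simp
  next
    fix d x y assume d: "d \<in> carrier F" and "(x, y) \<in> P"
    then obtain z v w where *: "x = z \<oplus>\<^bsub>L\<^esub> v" "y = b z \<oplus>\<^bsub>K\<^esub> w" "z \<in> ?LZ" "v \<in> C" "w \<in> C'" "(v, w) \<in> R"
      unfolding P_def by blast
    note c = cL[OF *(3,4)] cK[OF bz[OF *(3)] *(5)]
    have "d \<odot>\<^bsub>L\<^esub> x = d \<odot>\<^bsub>L\<^esub> z \<oplus>\<^bsub>L\<^esub> d \<odot>\<^bsub>L\<^esub> v" using * c d by (simp add: L.smult_r_distr)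
    moreover have "d \<odot>\<^bsub>K\<^esub> y = b (d \<odot>\<^bsub>L\<^esub> z) \<oplus>\<^bsub>K\<^esub> d \<odot>\<^bsub>K\<^esub> w" using * c d D by (simp add: b K.smult_r_distr)
    moreover have "d \<odot>\<^bsub>L\<^esub> z \<in> ?LZ" using submodule.smult_closed[OF LZ d] * by blast
    moreover have "(d \<odot>\<^bsub>L\<^esub> v, d \<odot>\<^bsub>K\<^esub> w) \<in> R" using * rel_smult d by blast
    ultimately have "(d \<odot>\<^bsub>L\<^esub> x, d \<odot>\<^bsub>K\<^esub> y) \<in> P" using PI * d by simp
    then show "(d \<odot>\<^bsub>L\<lparr>carrier := grade L p\<rparr>\<^esub> x, d \<odot>\<^bsub>K\<lparr>carrier := grade K p\<rparr>\<^esub> y) \<in> P" by simp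
  next
    fix x assume "x \<in> carrier (L\<lparr>carrier := grade L p\<rparr>)"
    then obtain v z where vz: "v \<in> C" "z \<in> ?LZ" "x = v \<oplus>\<^bsub>L\<^esub> z" using C(4)[of x] by auto
    then obtain k where k: "k \<in> grade K p" "(v, k) \<in> R" using rel_total C(2) by blast
    then obtain w z' where wz: "w \<in> C'" "z' \<in> ?KZ" "k = w \<oplus>\<^bsub>K\<^esub> z'" using C'(4) by blast
    note c = cL[OF vz(2,1)] cK[OF wz(2,1)]
    \<comment> \<open>Subtracting this central pair moves the partner k of v into the complement
      \<open>C'\<close>.\<close>
    have "(\<zero>\<^bsub>L\<^esub>, z') \<in> R" using center_rel wz submodule.zero_closed[OF L.center_submodule] by blast
    then have "(v \<ominus>\<^bsub>L\<^esub> \<zero>\<^bsub>L\<^esub>, k \<ominus>\<^bsub>K\<^esub> z') \<in> R" using k rel_minus by blast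
    moreover have "k \<ominus>\<^bsub>K\<^esub> z' = w" using wz c by (simp add: a_minus_def K.M.a_assoc K.M.r_neg)
    ultimately have "(v, w) \<in> R" using c by (simp add: L.diff_zero)
    then show "\<exists>w. (x, w) \<in> P" using PI[of z v w] vz wz c by (auto simp: L.M.a_comm)
  next
    fix x assume "(x, \<zero>\<^bsub>K\<lparr>carrier := grade K p\<rparr>\<^esub>) \<in> P"
    then obtain z v w where *: "x = z \<oplus>\<^bsub>L\<^esub> v" "b z \<oplus>\<^bsub>K\<^esub> w = \<zero>\<^bsub>K\<^esub>" "z \<in> ?LZ" "v \<in> C" "w \<in> C'" "(v, w) \<in> R"
      unfolding P_def by auto
    note c = cL[OF *(3,4)] cK[OF bz[OF *(3)] *(5)]
    \<comment> \<open>Now w is central and lies in \<open>C'\<close>, so it vanishes; then v is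
      central and lies in \<open>C\<close>, so it vanishes too, and injectivity of \<open>b\<close>
      disposes of z.\<close>
    have "w = \<zero>\<^bsub>K\<^esub> \<ominus>\<^bsub>K\<^esub> b z"
      using c *(2) by (metis K.M.a_comm K.M.minus_equality K.M.l_zero K.M.a_inv_closed a_minus_def)
    then have "w \<in> ?KZ" using K.submodule_minus[OF KZ submodule.zero_closed[OF KZ] bz[OF *(3)]] by simp
    then have w: "w = \<zero>\<^bsub>K\<^esub>" using *(5) C'(3) by blast
    then have "v \<in> center L" using rel_center[OF *(6)] submodule.zero_closed[OF K.center_submodule] by simp
    then have v: "v = \<zero>\<^bsub>L\<^esub>" using * C(2,3) by blast
    have z0: "\<zero>\<^bsub>L\<^esub> \<in> derived_set F L" using submodule.zero_closed[OF L.derived_submodule] .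
    have "b z = \<zero>\<^bsub>K\<^esub>" using * w c by simp
    moreover have "inj_on b (derived_set F L)" using b(6) by (simp add: bij_betw_def)
    ultimately have "z = \<zero>\<^bsub>L\<^esub>" using z0 D[of z] *(3) derived_iso_zero by (metis IntD1 inj_onD)
    then show "x = \<zero>\<^bsub>L\<lparr>carrier := grade L p\<rparr>\<^esub>" using * v by simp
  qed
qed

end

section \<open>Existence and dimension criterion within a family\<close>

theorem lemma4p2:
  fixes F :: "('f, 'm) ring_scheme" and C :: "('f, 'a) superalgebra set"
  assumes "field F" and "ring_char F \<noteq> 2" and "ring_char F \<noteq> 3"
    and "C \<in> isoclinism_families F"
  shows "(\<exists>T\<in>C. stem F T) \<and>
    (\<forall>T\<in>C. vectorspace.fin_dim F T \<longrightarrow>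
      (stem F T \<longleftrightarrow>
        (\<forall>L\<in>C. edim F (T\<lparr>carrier := grade T 0\<rparr>) \<le> edim F (L\<lparr>carrier := grade L 0\<rparr>)
             \<and> edim F (T\<lparr>carrier := grade T 1\<rparr>) \<le> edim F (L\<lparr>carrier := grade L 1\<rparr>))))"
proof -
  obtain L0 where L0: "lie_superalgebra F L0" and C: "C = isoclinism F `` {L0}"
    using assms(4) unfolding isoclinism_families_def by (auto elim: quotientE)
  have mem: "T \<in> C \<longleftrightarrow> lie_superalgebra F T \<and> isoclinic F L0 T" for T
    using L0 by (auto simp: C isoclinism_def)
  have relC: "\<exists>R b. isoclinism_relation F L0 T R b" if "T \<in> C" for T
    using that L0 isoclinism_relation_of_isoclinic unfolding mem by metis
  have CI: "T \<in> C" if "isoclinism_relation F L0 T R b" for T R b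
    unfolding mem using that isoclinism_relation.isoclinic isoclinism_relation.axioms(2) by blast
  have stemI: "stem F T"
    if T: "T \<in> C" and fin: "vectorspace.fin_dim F T"
      and min: "\<And>L p. L \<in> C \<Longrightarrow> edim F (T\<lparr>carrier := grade T p\<rparr>) \<le> edim F (L\<lparr>carrier := grade L p\<rparr>)" for T
  proof -
    interpret T: lie_superalgebra F T using T by (simp add: mem)
    obtain W where W: "T.homogeneous W" "derived_set F T \<subseteq> W" "W \<inter> center T \<subseteq> derived_set F T"
      "\<And>x. x \<in> carrier T \<Longrightarrow> \<exists>w\<in>W. \<exists>z\<in>center T. x = w \<oplus>\<^bsub>T\<^esub> z"
      using T.ex_stem_subspace by blast
    interpret S: central_supplement F T W by unfold_locales (use W in auto)
    let ?S = "restrict_super T W"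
    obtain R b where "isoclinism_relation F L0 T R b" using relC T by blast
    from isoclinism_relation_comp[OF this S.isoclinism_relation_T] have "?S \<in> C" by (rule CI)
    \<comment> \<open>The subalgebra \<open>?S\<close> belongs to the family, so minimality bounds
      each graded dimension of \<open>T\<close> by that of \<open>?S\<close>. Since the graded parts
      of \<open>?S\<close> are subspaces of those of \<open>T\<close>, finite dimension forces
      equality.\<close>
    have gr: "grade T p \<inter> W = grade T p" for p
    proof (rule T.submodule_eq_if_edim_le[OF fin])
      show sub: "submodule F (grade T p \<inter> W) T" "submodule F (grade T p) T"
        using T.submodule_Int[OF T.grade_submodule S.W_submodule] T.grade_submodule by auto
      have "edim F (T\<lparr>carrier := grade T p\<rparr>) \<le> edim F (?S\<lparr>carrier := grade ?S p\<rparr>)"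
        using \<open>?S \<in> C\<close> by (rule min)
      \<comment> \<open>The two records share carrier and linear operations and differ in the
        grading, which does not affect \<open>edim\<close>.\<close>
      also have "\<dots> \<le> edim F (T\<lparr>carrier := grade T p \<inter> W\<rparr>)"
        using S.T.submodule_vs[OF S.T.grade_submodule, of p] T.submodule_vs[OF sub(1)]
        by (intro edim_mono) simp_all
      finally show "edim F (T\<lparr>carrier := grade T p\<rparr>) \<le> edim F (T\<lparr>carrier := grade T p \<inter> W\<rparr>)" .
    qed auto
    have "carrier T \<subseteq> W"
    proof
      fix x assume "x \<in> carrier T"
      then obtain u v where "u \<in> grade T 0" "v \<in> grade T (0 + 1)" "x = u \<oplus>\<^bsub>T\<^esub> v" using T.decompose by blast
      then show "x \<in> W" using gr submodule.m_closed[OF S.W_submodule] by blast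
    qed
    then show ?thesis using W(3) T.center_closed unfolding stem_def by blast
  qed
  have "\<exists>T\<in>C. stem F T"
  proof -
    interpret L0: lie_superalgebra F L0 by (fact L0)
    obtain W where W: "L0.homogeneous W" "derived_set F L0 \<subseteq> W" "W \<inter> center L0 \<subseteq> derived_set F L0"
      "\<And>x. x \<in> carrier L0 \<Longrightarrow> \<exists>w\<in>W. \<exists>z\<in>center L0. x = w \<oplus>\<^bsub>L0\<^esub> z"
      using L0.ex_stem_subspace by blast
    interpret central_supplement F L0 W by unfold_locales (use W in auto)
    \<comment> \<open>The center of \<open>T\<close> is Z(L0) \<inter> W, which lies in the derived
      set of \<open>L0\<close>, and this is also the derived set of \<open>T\<close>.\<close>
    have "stem F T" using W(3) by (auto simp: stem_def center_T derived_set_T)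
    then show ?thesis using CI[OF isoclinism_relation_T] by blast
  qed
  moreover have "edim F (T\<lparr>carrier := grade T p\<rparr>) \<le> edim F (L\<lparr>carrier := grade L p\<rparr>)"
    if T: "T \<in> C" "stem F T" and L: "L \<in> C" for T L p
  proof -
    obtain R b S c where "isoclinism_relation F L0 T R b" "isoclinism_relation F L0 L S c"
      using relC T(1) L by metis
    \<comment> \<open>\<open>T\<close> and \<open>L\<close> are linked through the representative
      \<open>L0\<close> of the family.\<close>
    then have "isoclinism_relation F T L (R\<inverse> O S) (c \<circ> inv_into (derived_set F L0) b)"
      by (blast intro: isoclinism_relation_comp isoclinism_relation.converse)
    then show ?thesis using T(2) by (rule isoclinism_relation.stem_edim_grade_le)
  qed
  moreover have "stem F T" if "T \<in> C" "vectorspace.fin_dim F T"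
    and min: "\<forall>L\<in>C. edim F (T\<lparr>carrier := grade T 0\<rparr>) \<le> edim F (L\<lparr>carrier := grade L 0\<rparr>)
      \<and> edim F (T\<lparr>carrier := grade T 1\<rparr>) \<le> edim F (L\<lparr>carrier := grade L 1\<rparr>)" for T
  proof (rule stemI)
    show "edim F (T\<lparr>carrier := grade T p\<rparr>) \<le> edim F (L\<lparr>carrier := grade L p\<rparr>)" if "L \<in> C" for L p
      using bspec[OF min that] by (cases p) simp_all
  qed fact+
  ultimately show ?thesis by blast
qed

end
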